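(* Let $\tau=k+\theta$ with $k\in\mathbb{N}_0$, let $h(t)$ be a 1:1-periodic orbit, with phase $\alpha$, no degenerate zeros and $h'(\alpha)>0$, of $$h'(t)=-\operatorname{sign}(h(t-\tau))+c\cos(2\pi t),$$ let $\widetilde h(t)$ be a small perturbation of $h$ satisfying $\widetilde h'(t)=-\operatorname{sign}(\widetilde h(t-\tau))+c\cos(2\pi t)$, and let $\mathcal{E}(t)=\widetilde h(t)-h(t)$. Let $m\in\mathbb{Z}$. For $\theta\in(0,\tfrac12)$, to leading order, $$\mathcal{E}(m+1+\alpha)=\mathcal{E}(m+\alpha)-\frac{2\mathcal{E}(m-k+\alpha)}{h'(\alpha)}-\frac{2\mathcal{E}(m-k+\alpha+\tfrac12)}{h'(\alpha)},$$ $$\mathcal{E}(m+\tfrac32+\alpha)=\mathcal{E}(m+\tfrac12+\alpha)-\frac{2\mathcal{E}(m-k+\alpha+\tfrac12)}{h'(\alpha)}-\frac{2\mathcal{E}(m-k+\alpha+1)}{h'(\alpha)}.$$ For $\theta\in(\tfrac12,1)$, to leading order, $$\mathcal{E}(m+1+\alpha)=\mathcal{E}(m+\alpha)-\frac{2\mathcal{E}(m-k-\tfrac12+\alpha)}{h'(\alpha)}-\frac{2\mathcal{E}(m-k+\alpha)}{h'(\alpha)},$$ $$\mathcal{E}(m+\tfrac32+\alpha)=\mathcal{E}(m+\tfrac12+\alpha)-\frac{2\mathcal{E}(m-k+\alpha)}{h'(\alpha)}-\frac{2\mathcal{E}(m-k+\alpha+\tfrac12)}{h'(\alpha)}.$$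
   Context: $c\ge0$, $\operatorname{sign}(0)=0$, $\mathbb{N}_0=\{0,1,2,\dots\}$. A solution is a locally absolutely continuous function satisfying the equation for almost every $t$. A nondegenerate zero of $h$ is a $z$ with $h(z)=0$ for which there is $\delta>0$ with $h(z_-)h(z_+)<0$ for all $z_-\in(z-\delta,z)$, $z_+\in(z,z+\delta)$; other zeros are degenerate. A 1:1-periodic orbit is a solution on $\mathbb{R}$ of prime period $1$ with finitely many zeros per period and exactly one nondegenerate upward crossing of zero per period; the phase $\alpha$ is the location of such an upward crossing. "To leading order" means up to errors quadratic in the perturbation: for given $h$ there are constants $\delta_0,C>0$ (independent of $m$ and $\widetilde h$) such that, if $\widetilde h$ is continuous on $[m+\alpha-2\tau-1,\,m+\alpha+2]$, solves the equation on $[m+\alpha-\tau-1,\,m+\alpha+2]$, and $|\mathcal{E}(t)|\le\delta_0$ on $[m+\alpha-2\tau-1,\,m+\alpha+2]$, then the two sides of each displayed identity differ by at most $C\bigl(\mathcal{E}(s_1)^2+\mathcal{E}(s_2)^2\bigr)$, where $s_1,s_2$ are the two arguments at which $\mathcal{E}$ appears divided by $h'(\alpha)$ in that identity. *)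

theory Defs
  imports "HOL-Analysis.Analysis"
begin

text \<open>
  Classical absolute continuity of functions. (The constant \<open>absolutely_continuous\<close> of the library
  is about measures.) The members of \<open>D\<close> are non-overlapping compact intervals \<open>[Inf K, Sup K]\<close>
  contained in \<open>S\<close>.
\<close>

definition abs_continuous_on :: "real set \<Rightarrow> (real \<Rightarrow> real) \<Rightarrow> bool" where
  "abs_continuous_on S f \<longleftrightarrow>
     (\<forall>\<epsilon>>0. \<exists>\<delta>>0. \<forall>D T. D division_of T \<and> T \<subseteq> S \<and> (\<Sum>K\<in>D. measure lborel K) < \<delta>
        \<longrightarrow> (\<Sum>K\<in>D. \<bar>f (Sup K) - f (Inf K)\<bar>) < \<epsilon>)"

definition locally_abs_continuous_on :: "real set \<Rightarrow> (real \<Rightarrow> real) \<Rightarrow> bool" where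
  "locally_abs_continuous_on S f \<longleftrightarrow> (\<forall>a b. {a..b} \<subseteq> S \<longrightarrow> abs_continuous_on {a..b} f)"

text \<open>
  Solution on the interval \<open>S\<close>. The values of \<open>h\<close> on \<open>S - \<tau>\<close> enter through the delayed term;
  the endpoints of \<open>S\<close>, where the two-sided derivative would look outside \<open>S\<close>, are a null set.
\<close>

definition dde_solution_on :: "real \<Rightarrow> real \<Rightarrow> real set \<Rightarrow> (real \<Rightarrow> real) \<Rightarrow> bool" where
  "dde_solution_on c \<tau> S h \<longleftrightarrow>
     locally_abs_continuous_on S h \<and>
     (AE t in lborel. t \<in> S \<longrightarrow>
        (h has_real_derivative (- sgn (h (t - \<tau>)) + c * cos (2 * pi * t))) (at t))"

definition nondegenerate_zero :: "(real \<Rightarrow> real) \<Rightarrow> real \<Rightarrow> bool" where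
  "nondegenerate_zero h z \<longleftrightarrow>
     h z = 0 \<and> (\<exists>\<delta>>0. \<forall>u\<in>{z-\<delta><..<z}. \<forall>v\<in>{z<..<z+\<delta>}. h u * h v < 0)"

definition upward_crossing :: "(real \<Rightarrow> real) \<Rightarrow> real \<Rightarrow> bool" where
  "upward_crossing h z \<longleftrightarrow>
     nondegenerate_zero h z \<and>
     (\<exists>\<delta>>0. (\<forall>u\<in>{z-\<delta><..<z}. h u < 0) \<and> (\<forall>v\<in>{z<..<z+\<delta>}. h v > 0))"

definition has_period :: "(real \<Rightarrow> real) \<Rightarrow> real \<Rightarrow> bool" where
  "has_period h p \<longleftrightarrow> (\<forall>t. h (t + p) = h t)"

definition has_prime_period :: "(real \<Rightarrow> real) \<Rightarrow> real \<Rightarrow> bool" where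
  "has_prime_period h p \<longleftrightarrow> 0 < p \<and> has_period h p \<and> (\<forall>q. 0 < q \<and> q < p \<longrightarrow> \<not> has_period h q)"

text \<open>By periodicity, the period window \<open>[0, 1)\<close> is representative.\<close>

definition periodic_orbit_1_1 :: "real \<Rightarrow> real \<Rightarrow> (real \<Rightarrow> real) \<Rightarrow> bool" where
  "periodic_orbit_1_1 c \<tau> h \<longleftrightarrow>
     dde_solution_on c \<tau> UNIV h \<and>
     has_prime_period h 1 \<and>
     finite {t \<in> {0..<1}. h t = 0} \<and>
     (\<exists>!z. z \<in> {0..<1} \<and> upward_crossing h z)"

definition small_perturbation ::
  "real \<Rightarrow> real \<Rightarrow> real \<Rightarrow> int \<Rightarrow> real \<Rightarrow> (real \<Rightarrow> real) \<Rightarrow> (real \<Rightarrow> real) \<Rightarrow> bool" where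
  "small_perturbation c \<tau> \<alpha> m \<delta>\<^sub>0 h g \<longleftrightarrow>
     continuous_on {of_int m + \<alpha> - 2 * \<tau> - 1 .. of_int m + \<alpha> + 2} g \<and>
     dde_solution_on c \<tau> {of_int m + \<alpha> - \<tau> - 1 .. of_int m + \<alpha> + 2} g \<and>
     (\<forall>t\<in>{of_int m + \<alpha> - 2 * \<tau> - 1 .. of_int m + \<alpha> + 2}. \<bar>g t - h t\<bar> \<le> \<delta>\<^sub>0)"

end

(*
  A perturbation E = g - h satisfies E'(t) = sgn h(t - \<tau>) - sgn g(t - \<tau>), so E changes over a unit
  interval by an integral that only sees how far the zeros of g are displaced from those of h.

  The orbit has one upward and one downward zero per period; since h' integrates to 0 over a period,
  they are half a period apart, and then h(t + 1/2) = - h(t). As \<theta> is neither 0 nor 1/2, t - \<tau> stays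
  away from the zeros of h when t is near one of them. Hence near its zeros h is smooth with slope
  \<plusminus>h'(\<alpha>) and E is exactly constant, so that g has there a single zero, displaced by
  -E/h' + O(E^2). Each of the two displaced zeros in the delayed window contributes twice its
  displacement, up to sign.

  Both cases are treated at once by writing \<tau> = i/2 + \<kappa> with 0 < \<kappa> < 1/2.
*)

theory Submission
  imports Defs
begin

text \<open>Solutions satisfy the equation only almost everywhere, so the equation is first turned
  into an exact integral identity. The gauge integral does this without measurability or
  integrability conditions on the delayed sign. The error is purely quadratic because its only
  source is the Taylor remainder of \<open>h\<close> at its zeros. The constancy of the perturbation
  near a zero costs nothing, but it requires \<open>g\<close> and \<open>h\<close> to have equal
  signs one delay earlier; this is why closeness is demanded back to about two delays before the
  step. Both delayed zeros enter with the same factor \<open>-2 / h'(\<alpha>)\<close>: passing from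
  an upward to a downward zero reverses the displacement and also the jump of the sign, and the two
  reversals cancel. Uniformity in \<open>m\<close> comes from antiperiodicity: every zero is
  \<open>\<alpha> + n/2\<close>, and around it \<open>h\<close> is plus or minus its copy around
  \<open>\<alpha>\<close>, so constants chosen at \<open>\<alpha>\<close> serve everywhere.\<close>

section \<open>The fundamental theorem of calculus for absolutely continuous functions\<close>

text \<open>
  The integral is that of Henstock and Kurzweil. The gauge confines the intervals tagged by points
  of the exceptional null set to an open set of small measure, where absolute continuity bounds the
  increments of \<open>f\<close>.
\<close>

theorem abs_continuous_has_integral:
  fixes f \<phi> :: "real \<Rightarrow> real"
  assumes ab: "a \<le> b" and ac: "abs_continuous_on {a..b} f"
    and deriv: "AE t in lborel. t \<in> {a..b} \<longrightarrow> (f has_real_derivative \<phi> t) (at t)"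
  shows "(\<phi> has_integral f b - f a) {a..b}"
proof -
  obtain N where N: "N \<in> null_sets lborel"
    and "{t \<in> space lborel. \<not> (t \<in> {a..b} \<longrightarrow> (f has_real_derivative \<phi> t) (at t))} \<subseteq> N"
    using deriv unfolding eventually_ae_filter by blast
  then have derivN: "\<And>t. t \<in> {a..b} \<Longrightarrow> t \<notin> N \<Longrightarrow> (f has_real_derivative \<phi> t) (at t)"
    by auto
  have N_leb: "N \<in> null_sets lebesgue" and negl: "negligible N"
    using null_sets_completionI[OF N] by (simp_all add: negligible_iff_null_sets)
  \<comment> \<open>Setting the integrand to 0 on the null set makes the intervals tagged there
    contribute only increments of \<open>f\<close>; the spike rule at the end restores
    \<open>\<phi>\<close>.\<close>
  define \<psi> where "\<psi> t = (if t \<in> N then 0 else \<phi> t)" for t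
  have "(\<psi> has_integral f b - f a) {a..b}"
    unfolding has_integral_real
  proof safe
    fix e :: real assume "e > 0"
    \<comment> \<open>The summand 1 keeps the denominator positive for \<open>a = b\<close> and
      makes the total off the null set strictly less than \<open>e / 2\<close>.\<close>
    define e' where "e' = e / (2 * (b - a + 1))"
    have e': "e' > 0" "e' * (b - a) < e / 2"
      using \<open>e > 0\<close> ab by (auto simp: e'_def field_simps)
    obtain \<delta> where \<delta>: "\<delta> > 0"
      and ac\<delta>: "\<And>D T. D division_of T \<Longrightarrow> T \<subseteq> {a..b} \<Longrightarrow> (\<Sum>K\<in>D. measure lborel K) < \<delta> \<Longrightarrow>
        (\<Sum>K\<in>D. \<bar>f (Sup K) - f (Inf K)\<bar>) < e / 2"
      using ac \<open>e > 0\<close> unfolding abs_continuous_on_def by (metis half_gt_zero)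
    obtain U where U: "open U" "N \<subseteq> U" "U - N \<in> lmeasurable"
      and U\<delta>: "emeasure lebesgue (U - N) < ennreal \<delta>"
      using sets_lebesgue_outer_open[of N \<delta>] \<delta> N_leb by auto
    have U_meas: "U \<in> lmeasurable"
      using fmeasurable.Un[OF U(3) negligible_imp_measurable[OF negl]] U(2) by (simp add: Un_absorb2)
    have "measure lebesgue (U - N) < \<delta>"
      using U\<delta> U(3) by (simp add: emeasure_eq_measure2 ennreal_less_iff)
    then have U_small: "measure lebesgue U < \<delta>"
      using measure_Diff_null_set[OF _ N_leb, of U] U_meas by (simp add: fmeasurableD)
    have "\<exists>r>0. x \<in> {a..b} \<longrightarrow> x \<notin> N \<longrightarrow>
        (\<forall>y. \<bar>y - x\<bar> < r \<longrightarrow> \<bar>f y - f x - \<phi> x * (y - x)\<bar> \<le> e' * \<bar>y - x\<bar>)" for x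
    proof (cases "x \<in> {a..b} \<and> x \<notin> N")
      case True
      then have "(f has_derivative (*) (\<phi> x)) (at x)"
        using derivN has_field_derivative_def by blast
      then obtain r where "r > 0"
        "\<forall>y. norm (y - x) < r \<longrightarrow> norm (f y - f x - \<phi> x * (y - x)) \<le> e' * norm (y - x)"
        using e'(1) unfolding has_derivative_at_alt by blast
      then show ?thesis
        by (intro exI[of _ r]) simp
    qed (auto intro: exI[of _ 1])
    then have "\<exists>r. \<forall>x. r x > 0 \<and> (x \<in> {a..b} \<longrightarrow> x \<notin> N \<longrightarrow>
        (\<forall>y. \<bar>y - x\<bar> < r x \<longrightarrow> \<bar>f y - f x - \<phi> x * (y - x)\<bar> \<le> e' * \<bar>y - x\<bar>))"
      by (intro choice allI) blast
    then obtain r where r: "\<And>x. r x > 0"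
      and rd: "\<And>x y. x \<in> {a..b} \<Longrightarrow> x \<notin> N \<Longrightarrow> \<bar>y - x\<bar> < r x \<Longrightarrow>
        \<bar>f y - f x - \<phi> x * (y - x)\<bar> \<le> e' * \<bar>y - x\<bar>"
      by blast
    define \<gamma> where "\<gamma> x = (if x \<in> N then U else ball x (r x))" for x
    have "gauge \<gamma>"
      using U r by (auto simp: gauge_def \<gamma>_def)
    moreover have "norm ((\<Sum>(x,K)\<in>p. measure lborel K *\<^sub>R \<psi> x) - (f b - f a)) < e"
      if p: "p tagged_division_of {a..b}" and fine: "\<gamma> fine p" for p
    proof -
      define q where "q = {(x,K) \<in> p. x \<in> N}"
      have finp: "finite p" and qp: "q \<subseteq> p"
        using tagged_division_ofD(1)[OF p] by (auto simp: q_def)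
      have K: "\<exists>u v. K = {u..v} \<and> u \<le> x \<and> x \<le> v \<and> {u..v} \<subseteq> {a..b}" if "(x,K) \<in> p" for x K
        using tagged_division_ofD(2-4)[OF p that] by auto
      have qpart: "q tagged_partial_division_of {a..b}"
        using tagged_partial_division_subset[OF _ qp] p by (simp add: tagged_division_of_def)
      have qdiv: "snd ` q division_of \<Union>(snd ` q)"
        by (rule partial_division_of_tagged_division[OF qpart])
      have Uq: "\<Union>(snd ` q) \<subseteq> U" "\<Union>(snd ` q) \<subseteq> {a..b}"
      proof -
        have "K \<subseteq> U \<and> K \<subseteq> {a..b}" if "(x,K) \<in> q" for x K
          using that fineD[OF fine, of x K] tagged_division_ofD(3)[OF p, of x K]
          by (auto simp: q_def \<gamma>_def)
        then show "\<Union>(snd ` q) \<subseteq> U" "\<Union>(snd ` q) \<subseteq> {a..b}"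
          by (force simp del: atLeastAtMost_iff)+
      qed
      have "(\<Sum>K\<in>snd ` q. measure lborel K) = (\<Sum>K\<in>snd ` q. measure lebesgue K)"
      proof (intro sum.cong refl)
        fix K assume "K \<in> snd ` q"
        then obtain u v where "K = cbox u v"
          using division_ofD(4)[OF qdiv] by blast
        then show "measure lborel K = measure lebesgue K" by simp
      qed
      also have "\<dots> = measure lebesgue (\<Union>(snd ` q))"
        by (rule content_division[OF qdiv])
      also have "\<dots> \<le> measure lebesgue U"
        using Uq(1) U_meas lmeasurable_division[OF qdiv] by (intro measure_mono_fmeasurable) auto
      finally have small: "(\<Sum>K\<in>snd ` q. \<bar>f (Sup K) - f (Inf K)\<bar>) < e / 2"
        using U_small ac\<delta>[OF qdiv Uq(2)] by simp
      \<comment> \<open>Different tags may carry the same interval if it is degenerate. Passing from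
        tagged intervals to the set of intervals needs a summand vanishing on these, and
        \<open>Inf\<close> and \<open>Sup\<close> say nothing useful about the empty set.\<close>
      define d where "d K = (if K = {} then 0 else \<bar>f (Sup K) - f (Inf K)\<bar>)" for K
      have "(\<Sum>(x,K)\<in>q. \<bar>f (Sup K) - f (Inf K)\<bar>) = (\<Sum>(x,K)\<in>q. d K)"
      proof (intro sum.cong refl, clarify)
        fix x K assume "(x,K) \<in> q"
        then have "K \<noteq> {}" using tagged_division_ofD(2)[OF p, of x K] qp by auto
        then show "\<bar>f (Sup K) - f (Inf K)\<bar> = d K" by (simp add: d_def)
      qed
      also have "\<dots> = sum d (snd ` q)"
        by (rule sum.over_tagged_division_lemma[OF tagged_partial_division_of_Union_self[OF qpart]])
          (auto simp: d_def cbox_interval box_real)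
      also have "\<dots> \<le> (\<Sum>K\<in>snd ` q. \<bar>f (Sup K) - f (Inf K)\<bar>)"
        by (intro sum_mono) (auto simp: d_def)
      finally have sumq: "(\<Sum>(x,K)\<in>q. \<bar>f (Sup K) - f (Inf K)\<bar>) < e / 2"
        using small by simp
      have "\<bar>measure lborel K *\<^sub>R \<psi> x - (f (Sup K) - f (Inf K))\<bar> \<le>
          e' * (Sup K - Inf K) + (if x \<in> N then \<bar>f (Sup K) - f (Inf K)\<bar> else 0)"
        if xK: "(x,K) \<in> p" for x K
      proof -
        obtain u v where uv: "K = {u..v}" "u \<le> x" "x \<le> v" "{u..v} \<subseteq> {a..b}"
          using K[OF xK] by blast
        show ?thesis
        proof (cases "x \<in> N")
          case True
          moreover have "0 \<le> e' * (v - u)" using uv e'(1) by simp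
          ultimately show ?thesis using uv by (simp add: \<psi>_def abs_minus_commute)
        next
          case False
          \<comment> \<open>The tag splits the interval, and the derivative estimates on both sides
            of it add up, since \<open>u - x\<close> and \<open>v - x\<close> have opposite
            signs.\<close>
          have "{u..v} \<subseteq> ball x (r x)"
            using fineD[OF fine xK] False uv(1) by (simp add: \<gamma>_def)
          moreover have "u \<in> {u..v}" "v \<in> {u..v}" using uv by auto
          ultimately have "u \<in> ball x (r x)" "v \<in> ball x (r x)" by blast+
          then have "\<bar>u - x\<bar> < r x" "\<bar>v - x\<bar> < r x"
            by (auto simp: dist_real_def)
          then have "\<bar>f u - f x - \<phi> x * (u - x)\<bar> \<le> e' * (x - u)"
            "\<bar>f v - f x - \<phi> x * (v - x)\<bar> \<le> e' * (v - x)"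
            using rd[of x u] rd[of x v] uv False by auto
          moreover have "\<phi> x * (v - u) = \<phi> x * (v - x) - \<phi> x * (u - x)"
            "e' * (v - u) = e' * (v - x) + e' * (x - u)"
            by (simp_all add: algebra_simps)
          ultimately have "\<bar>\<phi> x * (v - u) - (f v - f u)\<bar> \<le> e' * (v - u)"
            by linarith
          then show ?thesis using uv False by (simp add: \<psi>_def mult.commute)
        qed
      qed
      then have "\<bar>\<Sum>(x,K)\<in>p. measure lborel K *\<^sub>R \<psi> x - (f (Sup K) - f (Inf K))\<bar> \<le>
          (\<Sum>(x,K)\<in>p. e' * (Sup K - Inf K) + (if x \<in> N then \<bar>f (Sup K) - f (Inf K)\<bar> else 0))"
        by (intro order_trans[OF sum_abs] sum_mono) auto
      also have "\<dots> = e' * (\<Sum>(x,K)\<in>p. Sup K - Inf K) +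
          (\<Sum>(x,K)\<in>p. if x \<in> N then \<bar>f (Sup K) - f (Inf K)\<bar> else 0)"
        by (simp add: case_prod_unfold sum.distrib sum_distrib_left)
      finally have "\<bar>\<Sum>(x,K)\<in>p. measure lborel K *\<^sub>R \<psi> x - (f (Sup K) - f (Inf K))\<bar> \<le>
          e' * (\<Sum>(x,K)\<in>p. Sup K - Inf K) +
          (\<Sum>(x,K)\<in>p. if x \<in> N then \<bar>f (Sup K) - f (Inf K)\<bar> else 0)" .
      moreover have "(\<Sum>(x,K)\<in>p. Sup K - Inf K) = b - a"
        by (rule additive_tagged_division_1[OF ab p])
      moreover have "(\<Sum>(x,K)\<in>p. if x \<in> N then \<bar>f (Sup K) - f (Inf K)\<bar> else 0) =
          (\<Sum>(x,K)\<in>q. \<bar>f (Sup K) - f (Inf K)\<bar>)"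
      proof (rule sum.mono_neutral_cong_right[OF finp qp])
        show "\<forall>i\<in>p - q. (case i of (x, K) \<Rightarrow> if x \<in> N then \<bar>f (Sup K) - f (Inf K)\<bar> else 0) = 0"
          by (auto simp: q_def split: if_splits)
        show "(case i of (x, K) \<Rightarrow> if x \<in> N then \<bar>f (Sup K) - f (Inf K)\<bar> else 0) =
            (case i of (x, K) \<Rightarrow> \<bar>f (Sup K) - f (Inf K)\<bar>)" if "i \<in> q" for i
          using that by (auto simp: q_def)
      qed
      ultimately have "\<bar>\<Sum>(x,K)\<in>p. measure lborel K *\<^sub>R \<psi> x - (f (Sup K) - f (Inf K))\<bar> \<le>
          e' * (b - a) + (\<Sum>(x,K)\<in>q. \<bar>f (Sup K) - f (Inf K)\<bar>)"
        by (simp only:)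
      then have "\<bar>\<Sum>(x,K)\<in>p. measure lborel K *\<^sub>R \<psi> x - (f (Sup K) - f (Inf K))\<bar> < e"
        using sumq e'(2) by linarith
      moreover have "(\<Sum>(x,K)\<in>p. measure lborel K *\<^sub>R \<psi> x - (f (Sup K) - f (Inf K))) =
          (\<Sum>(x,K)\<in>p. measure lborel K *\<^sub>R \<psi> x) - (\<Sum>(x,K)\<in>p. f (Sup K) - f (Inf K))"
        unfolding case_prod_unfold by (rule sum_subtractf)
      ultimately show ?thesis
        unfolding additive_tagged_division_1[OF ab p, of f] real_norm_def by (simp only:)
    qed
    ultimately show "\<exists>\<gamma>. gauge \<gamma> \<and> (\<forall>\<D>. \<D> tagged_division_of {a..b} \<and> \<gamma> fine \<D> \<longrightarrow>
        norm ((\<Sum>(x, K)\<in>\<D>. measure lborel K *\<^sub>R \<psi> x) - (f b - f a)) < e)"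
      by (intro exI[of _ \<gamma>]) simp
  qed
  then show ?thesis
    by (rule has_integral_spike[OF negl, rotated]) (simp add: \<psi>_def)
qed

section \<open>Solutions of the delay equation\<close>

lemma dde_solution_on_subset:
  assumes "dde_solution_on c \<tau> S g" "T \<subseteq> S"
  shows "dde_solution_on c \<tau> T g"
  unfolding dde_solution_on_def
proof
  show "locally_abs_continuous_on T g"
    using assms by (auto simp: dde_solution_on_def locally_abs_continuous_on_def)
  have "AE t in lborel. t \<in> S \<longrightarrow>
      (g has_real_derivative - sgn (g (t - \<tau>)) + c * cos (2 * pi * t)) (at t)"
    using assms(1) by (simp add: dde_solution_on_def)
  then show "AE t in lborel. t \<in> T \<longrightarrow>
      (g has_real_derivative - sgn (g (t - \<tau>)) + c * cos (2 * pi * t)) (at t)"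
    by (rule eventually_mono) (use assms(2) in auto)
qed

lemma dde_solution_has_integral:
  assumes "dde_solution_on c \<tau> S h" "{a..b} \<subseteq> S" "a \<le> b"
  shows "((\<lambda>t. - sgn (h (t - \<tau>)) + c * cos (2 * pi * t)) has_integral h b - h a) {a..b}"
proof (rule abs_continuous_has_integral[OF assms(3)])
  show "abs_continuous_on {a..b} h"
    using assms by (auto simp: dde_solution_on_def locally_abs_continuous_on_def)
  have "AE t in lborel. t \<in> S \<longrightarrow>
      (h has_real_derivative - sgn (h (t - \<tau>)) + c * cos (2 * pi * t)) (at t)"
    using assms(1) by (simp add: dde_solution_on_def)
  then show "AE t in lborel. t \<in> {a..b} \<longrightarrow>
      (h has_real_derivative - sgn (h (t - \<tau>)) + c * cos (2 * pi * t)) (at t)"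
    by (rule eventually_mono) (use assms(2) in auto)
qed

text \<open>The forcing term cancels, and shifting the variable by \<open>\<tau>\<close> leaves
  undelayed signs on the delayed window, where zeros can be counted.\<close>

lemma dde_difference_has_integral:
  assumes "dde_solution_on c \<tau> S h" "dde_solution_on c \<tau> T g"
    and "{a..b} \<subseteq> S" "{a..b} \<subseteq> T" "a \<le> b"
  shows "((\<lambda>s. sgn (h s) - sgn (g s)) has_integral (g b - h b) - (g a - h a)) {a-\<tau>..b-\<tau>}"
proof -
  have "((\<lambda>t. (- sgn (g (t - \<tau>)) + c * cos (2 * pi * t)) - (- sgn (h (t - \<tau>)) + c * cos (2 * pi * t)))
      has_integral (g b - g a) - (h b - h a)) {a..b}"
    using assms by (intro has_integral_diff dde_solution_has_integral)
  then have "((\<lambda>t. sgn (h (t - \<tau>)) - sgn (g (t - \<tau>))) has_integral (g b - h b) - (g a - h a)) {a..b}"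
    by (simp add: algebra_simps)
  then show ?thesis
    by (subst has_integral_shift_real_ivl_iff[where c = "- \<tau>"]) simp
qed

text \<open>The right-hand side is bounded by \<open>1 + \<bar>c\<bar>\<close>. This serves to make
  solutions on the whole line continuous.\<close>

lemma dde_solution_lipschitz:
  assumes "dde_solution_on c \<tau> S h" "{a..b} \<subseteq> S" "a \<le> b"
  shows "\<bar>h b - h a\<bar> \<le> (1 + \<bar>c\<bar>) * (b - a)"
proof -
  have "norm (h b - h a) \<le> (1 + \<bar>c\<bar>) * measure lborel {a..b}"
  proof (rule has_integral_bound_real[OF _ finite.emptyI dde_solution_has_integral[OF assms]])
    fix t
    have "\<bar>c * cos (2 * pi * t)\<bar> \<le> \<bar>c\<bar>"
      by (simp add: abs_mult mult_left_le)
    then show "norm (- sgn (h (t - \<tau>)) + c * cos (2 * pi * t)) \<le> 1 + \<bar>c\<bar>"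
      by (auto simp: sgn_if)
  qed auto
  then show ?thesis using assms(3) by simp
qed

lemma dde_solution_continuous:
  assumes "dde_solution_on c \<tau> UNIV h"
  shows "continuous_on A h"
proof -
  have *: "dist (h x) (h y) \<le> (1 + \<bar>c\<bar>) * dist x y" for x y
    using dde_solution_lipschitz[OF assms, of x y] dde_solution_lipschitz[OF assms, of y x]
    by (cases "x \<le> y") (auto simp: dist_real_def abs_minus_commute)
  then have "(1 + \<bar>c\<bar>)-lipschitz_on A h"
    by (intro lipschitz_onI) auto
  then show ?thesis by (rule lipschitz_on_continuous_on)
qed

section \<open>Integrals of piecewise constant signs\<close>

lemma has_integral_sgn_const:
  fixes f :: "real \<Rightarrow> real"
  assumes "a \<le> b" "\<And>x. x \<in> {a<..<b} \<Longrightarrow> sgn (f x) = s"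
  shows "((\<lambda>x. sgn (f x)) has_integral s * (b - a)) {a..b}"
  using has_integral_spike_interior[OF has_integral_const[of s a b], of "\<lambda>x. sgn (f x)"] assms
  by (simp add: mult.commute)

text \<open>The inner break points enter only through \<open>2 * s * (q - r)\<close>: displacing a
  jump of the sign changes the integral by twice the displacement. This is the origin of the factor
  2 in the recursion.\<close>

lemma has_integral_sgn_alternating:
  fixes f :: "real \<Rightarrow> real"
  assumes le: "p \<le> q" "q \<le> r" "r \<le> w"
    and "\<And>x. x \<in> {p<..<q} \<Longrightarrow> sgn (f x) = s"
    and "\<And>x. x \<in> {q<..<r} \<Longrightarrow> sgn (f x) = - s"
    and "\<And>x. x \<in> {r<..<w} \<Longrightarrow> sgn (f x) = s"
  shows "((\<lambda>x. sgn (f x)) has_integral s * (2 * q - 2 * r + w - p)) {p..w}"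
proof -
  have "((\<lambda>x. sgn (f x)) has_integral s * (q - p) + - s * (r - q)) {p..r}"
    using le assms by (intro has_integral_combine[OF le(1,2)] has_integral_sgn_const) auto
  then have "((\<lambda>x. sgn (f x)) has_integral (s * (q - p) + - s * (r - q)) + s * (w - r)) {p..w}"
    using le assms by (intro has_integral_combine[of p r w] has_integral_sgn_const) auto
  then show ?thesis by (simp add: algebra_simps)
qed

section \<open>The shape of 1:1-periodic orbits\<close>

lemma has_period_of_int:
  assumes "has_period h 1"
  shows "h (t + of_int n) = h t"
proof -
  have nat: "h (t + of_nat k) = h t" for t k
  proof (induction k)
    case (Suc k)
    have "h (t + of_nat (Suc k)) = h (t + of_nat k + 1)"
      by (simp add: add_ac)
    then show ?case using assms Suc by (simp add: has_period_def)
  qed simp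
  show ?thesis
    using nat[of t "nat n"] nat[of "t + of_int n" "nat (- n)"] by (cases "n \<ge> 0") auto
qed

lemma upward_crossing_translate:
  assumes per: "\<And>t. h (t + p) = h t" and up: "upward_crossing h z"
  shows "upward_crossing h (z + p)"
proof -
  have per': "h (t - p) = h t" for t
    using per[of "t - p"] by simp
  obtain \<delta>1 where "\<delta>1 > 0" "h z = 0" and 1: "\<And>u v. u\<in>{z-\<delta>1<..<z} \<Longrightarrow> v\<in>{z<..<z+\<delta>1} \<Longrightarrow> h u * h v < 0"
    using up unfolding upward_crossing_def nondegenerate_zero_def by blast
  obtain \<delta>2 where "\<delta>2 > 0" and 2: "\<And>u. u\<in>{z-\<delta>2<..<z} \<Longrightarrow> h u < 0" "\<And>v. v\<in>{z<..<z+\<delta>2} \<Longrightarrow> h v > 0"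
    using up unfolding upward_crossing_def by blast
  have "h u * h v < 0" if "u\<in>{z+p-\<delta>1<..<z+p}" "v\<in>{z+p<..<z+p+\<delta>1}" for u v
    using 1[of "u - p" "v - p"] that by (simp add: per')
  moreover have "h u < 0" if "u\<in>{z+p-\<delta>2<..<z+p}" for u
    using 2(1)[of "u - p"] that by (simp add: per')
  moreover have "h v > 0" if "v\<in>{z+p<..<z+p+\<delta>2}" for v
    using 2(2)[of "v - p"] that by (simp add: per')
  ultimately show ?thesis
    unfolding upward_crossing_def nondegenerate_zero_def
    using \<open>\<delta>1 > 0\<close> \<open>\<delta>2 > 0\<close> \<open>h z = 0\<close> per[of z] by auto
qed

text \<open>Crossings are counted in the window from 0 to 1, whereas \<open>x\<close> and
  \<open>y\<close> may lie anywhere. Their fractional parts are crossings in that window and hence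
  agree, so \<open>y - x\<close> is a positive integer.\<close>

lemma orbit_upward_crossing_unique:
  assumes orb: "periodic_orbit_1_1 c \<tau> h" and "upward_crossing h x" "upward_crossing h y"
    and "x < y"
  shows "x + 1 \<le> y"
proof -
  have per: "has_period h 1"
    using orb by (simp add: periodic_orbit_1_1_def has_prime_period_def)
  have shift: "h (t - of_int n) = h t" for t n
    using has_period_of_int[OF per, of t "- n"] by simp
  have frac: "upward_crossing h (frac z) \<and> frac z \<in> {0..<1}" if "upward_crossing h z" for z
    using upward_crossing_translate[of h "of_int (- \<lfloor>z\<rfloor>)" z] shift that
    by (simp add: frac_def[symmetric] frac_lt_1)
  then have "frac x = frac y"
    using orb assms(2,3) unfolding periodic_orbit_1_1_def by blast
  then have "y - x = of_int (\<lfloor>y\<rfloor> - \<lfloor>x\<rfloor>)"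
    by (simp add: frac_def)
  then have "\<lfloor>y\<rfloor> - \<lfloor>x\<rfloor> > 0"
    using \<open>x < y\<close> by (metis diff_gt_0_iff_gt of_int_0_less_iff)
  then have "of_int (\<lfloor>y\<rfloor> - \<lfloor>x\<rfloor>) \<ge> (1::real)" by linarith
  with \<open>y - x = _\<close> show ?thesis by linarith
qed

text \<open>The zeros in \<open>{p..q}\<close> form a nonempty compact set, whose least element is
  taken. A nonpositive value before it would force an earlier zero.\<close>

lemma first_zero:
  fixes f :: "real \<Rightarrow> real"
  assumes cont: "continuous_on {p..q} f" and "f p > 0" "f q \<le> 0" "p \<le> q"
  obtains r where "p < r" "r \<le> q" "f r = 0" "\<And>x. x \<in> {p..<r} \<Longrightarrow> f x > 0"
proof -
  let ?Z = "{x \<in> {p..q}. f x = 0}"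
  have "closed ?Z"
    using continuous_closed_preimage_constant[OF cont] by simp
  moreover have "bounded ?Z"
    by (rule bounded_subset[OF bounded_closed_interval[of p q]]) auto
  ultimately have "compact ?Z"
    by (simp add: compact_eq_bounded_closed)
  obtain z where "z \<in> ?Z"
    using IVT2'[of f q 0 p] assms by (auto simp: less_imp_le)
  then obtain r where r: "r \<in> ?Z" "\<And>x. x \<in> ?Z \<Longrightarrow> r \<le> x"
    using compact_attains_inf[OF \<open>compact ?Z\<close>] by blast
  have "f x > 0" if "x \<in> {p..<r}" for x
  proof (rule ccontr)
    assume "\<not> f x > 0"
    then have "\<exists>y\<ge>p. y \<le> x \<and> f y = 0"
      using that r assms(2) continuous_on_subset[OF cont]
      by (intro IVT2') auto
    then show False using r that by force
  qed
  then show ?thesis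
    using r assms(2) by (intro that[of r]) (auto simp: less_le)
qed

text \<open>Nondegeneracy only says that the two sides have opposite signs; a known sign on the left
  decides the right.\<close>

lemma downward_of_nondegenerate:
  assumes "nondegenerate_zero h z" "p < z" "\<And>x. x \<in> {p..<z} \<Longrightarrow> h x > 0"
  obtains \<delta> where "\<delta> > 0" "\<And>x. x \<in> {z<..<z+\<delta>} \<Longrightarrow> h x < 0"
proof -
  obtain \<delta> where "\<delta> > 0" and \<delta>: "\<And>u v. u\<in>{z-\<delta><..<z} \<Longrightarrow> v\<in>{z<..<z+\<delta>} \<Longrightarrow> h u * h v < 0"
    using assms(1) unfolding nondegenerate_zero_def by blast
  \<comment> \<open>A single point that lies both where the sign is known and where nondegeneracy
    applies.\<close>
  define u where "u = max p (z - \<delta> / 2)"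
  have "h u > 0" "u \<in> {z-\<delta><..<z}"
    using assms \<open>\<delta> > 0\<close> by (auto simp: u_def)
  then show ?thesis
    using \<open>\<delta> > 0\<close> \<delta>[of u] by (intro that[of \<delta>]) (auto simp: mult_less_0_iff)
qed

lemma upward_of_nondegenerate:
  assumes nd: "nondegenerate_zero h z" and "p < z" "\<And>x. x \<in> {p..<z} \<Longrightarrow> h x < 0"
  shows "upward_crossing h z"
proof -
  obtain \<delta> where "\<delta> > 0" and \<delta>: "\<And>u v. u\<in>{z-\<delta><..<z} \<Longrightarrow> v\<in>{z<..<z+\<delta>} \<Longrightarrow> h u * h v < 0"
    using nd unfolding nondegenerate_zero_def by blast
  define u where "u = max p (z - \<delta> / 2)"
  have "h u < 0" "u \<in> {z-\<delta><..<z}"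
    using assms \<open>\<delta> > 0\<close> by (auto simp: u_def)
  then have pos: "h v > 0" if "v \<in> {z<..<z+\<delta>}" for v
    using \<delta>[of u v] that by (auto simp: mult_less_0_iff)
  show ?thesis
    unfolding upward_crossing_def
    using nd assms(2,3) pos \<open>\<delta> > 0\<close>
    by (intro conjI exI[of _ "min \<delta> (z - p)"]) auto
qed

text \<open>Here \<open>\<beta>\<close> is the first zero after \<open>\<alpha>\<close>, and
  \<open>h\<close> becomes negative behind it. The next zero after that is reached from below, hence
  is an upward crossing, and uniqueness keeps it at least a period away from
  \<open>\<alpha>\<close>.\<close>

lemma orbit_sign_pattern:
  assumes orb: "periodic_orbit_1_1 c \<tau> h" and up: "upward_crossing h \<alpha>"
    and nd: "\<And>z. h z = 0 \<Longrightarrow> nondegenerate_zero h z"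
  obtains \<beta> where "\<alpha> < \<beta>" "\<beta> < \<alpha> + 1" "h \<beta> = 0"
    "\<And>t. t \<in> {\<alpha><..<\<beta>} \<Longrightarrow> h t > 0" "\<And>t. t \<in> {\<beta><..<\<alpha>+1} \<Longrightarrow> h t < 0"
proof -
  have cont: "continuous_on A h" for A
    using orb dde_solution_continuous by (auto simp: periodic_orbit_1_1_def)
  have per: "h (t + 1) = h t" for t
    using orb by (auto simp: periodic_orbit_1_1_def has_prime_period_def has_period_def)
  obtain \<delta> where "\<delta> > 0" and neg: "\<And>u. u\<in>{\<alpha>-\<delta><..<\<alpha>} \<Longrightarrow> h u < 0"
    and pos: "\<And>v. v\<in>{\<alpha><..<\<alpha>+\<delta>} \<Longrightarrow> h v > 0"
    using up unfolding upward_crossing_def by blast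
  \<comment> \<open>The search for a zero cannot start at \<open>\<alpha>\<close>, where
    \<open>h\<close> vanishes. The factor 1/3 keeps \<open>\<eta>\<close> below
    \<open>\<delta>\<close> and \<open>\<alpha> + \<eta>\<close> to the left of
    \<open>\<alpha> + 1 - \<eta>\<close>.\<close>
  define \<eta> where "\<eta> = min \<delta> 1 / 3"
  have \<eta>: "0 < \<eta>" "\<eta> < \<delta>" "\<eta> \<le> 1/3"
    using \<open>\<delta> > 0\<close> by (auto simp: \<eta>_def)
  have "h (\<alpha> + \<eta>) > 0" "h (\<alpha> + 1 - \<eta>) < 0"
    using pos[of "\<alpha> + \<eta>"] neg[of "\<alpha> - \<eta>"] per[of "\<alpha> - \<eta>"] \<eta> by (auto simp: algebra_simps)
  then obtain \<beta> where \<beta>: "\<alpha> + \<eta> < \<beta>" "\<beta> \<le> \<alpha> + 1 - \<eta>" "h \<beta> = 0"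
    and pos\<beta>: "\<And>x. x \<in> {\<alpha>+\<eta>..<\<beta>} \<Longrightarrow> h x > 0"
    using first_zero[OF cont, of "\<alpha> + \<eta>" "\<alpha> + 1 - \<eta>"] \<eta> by (auto simp: less_imp_le)
  obtain \<rho> where "\<rho> > 0" and neg\<beta>: "\<And>x. x \<in> {\<beta><..<\<beta>+\<rho>} \<Longrightarrow> h x < 0"
    using downward_of_nondegenerate[OF nd[OF \<beta>(3)] \<beta>(1) pos\<beta>] by blast
  show thesis
  proof (rule that[of \<beta>])
    show "\<alpha> < \<beta>" "\<beta> < \<alpha> + 1" "h \<beta> = 0" using \<beta> \<eta> by auto
    show "h t > 0" if "t \<in> {\<alpha><..<\<beta>}" for t
      using that pos[of t] pos\<beta>[of t] \<eta> by (cases "t < \<alpha> + \<eta>") auto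
    show "h t < 0" if t: "t \<in> {\<beta><..<\<alpha>+1}" for t
    proof (rule ccontr)
      assume "\<not> h t < 0"
      \<comment> \<open>A point after \<open>\<beta>\<close> and before \<open>t\<close> at which
        \<open>h\<close> is already negative, from which the next zero is sought.\<close>
      define p where "p = \<beta> + min \<rho> (t - \<beta>) / 2"
      have p: "\<beta> < p" "p < t" "p < \<beta> + \<rho>"
        using \<open>\<rho> > 0\<close> t by (auto simp: p_def min_def field_simps)
      then have "h p < 0" using neg\<beta> by auto
      have "\<exists>\<gamma>>p. \<gamma> \<le> t \<and> h \<gamma> = 0 \<and> (\<forall>x\<in>{p..<\<gamma>}. h x < 0)"
      proof -
        have "\<exists>\<gamma>>p. \<gamma> \<le> t \<and> - h \<gamma> = 0 \<and> (\<forall>x\<in>{p..<\<gamma>}. - h x > 0)"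
          by (rule first_zero[OF continuous_on_minus[OF cont, of "{p..t}"]])
            (use p \<open>h p < 0\<close> \<open>\<not> h t < 0\<close> in auto)
        then show ?thesis by auto
      qed
      then obtain \<gamma> where \<gamma>: "p < \<gamma>" "\<gamma> \<le> t" "h \<gamma> = 0" "\<forall>x\<in>{p..<\<gamma>}. h x < 0"
        by blast
      then have "upward_crossing h \<gamma>"
        using upward_of_nondegenerate[OF nd] by blast
      then have "\<alpha> + 1 \<le> \<gamma>"
        using orbit_upward_crossing_unique[OF orb up] \<gamma> p \<beta> \<eta> by auto
      then show False using \<gamma> t by auto
    qed
  qed
qed

text \<open>Over a period both \<open>h'\<close> and the cosine integrate to 0, hence so does the
  sign of \<open>h\<close>, and this centres \<open>\<beta>\<close>. Then the sign, and with it the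
  whole right-hand side, flips under a shift by 1/2, so \<open>h (t + 1/2) + h t\<close> is
  constant; at \<open>\<alpha>\<close> both summands vanish.\<close>

lemma orbit_half_period:
  assumes orb: "periodic_orbit_1_1 c \<tau> h" and up: "upward_crossing h \<alpha>"
    and nd: "\<And>z. h z = 0 \<Longrightarrow> nondegenerate_zero h z"
  shows "\<And>t. h (t + 1/2) = - h t" "\<And>t. t \<in> {\<alpha><..<\<alpha>+1/2} \<Longrightarrow> h t > 0"
proof -
  obtain \<beta> where \<beta>: "\<alpha> < \<beta>" "\<beta> < \<alpha> + 1" "h \<beta> = 0"
    and pos: "\<And>t. t \<in> {\<alpha><..<\<beta>} \<Longrightarrow> h t > 0" and neg: "\<And>t. t \<in> {\<beta><..<\<alpha>+1} \<Longrightarrow> h t < 0"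
    using orbit_sign_pattern[OF assms] by blast
  have sol: "dde_solution_on c \<tau> UNIV h" and perh: "has_period h 1"
    using orb by (auto simp: periodic_orbit_1_1_def has_prime_period_def)
  have h\<alpha>: "h \<alpha> = 0" using up by (simp add: upward_crossing_def nondegenerate_zero_def)
  have "((\<lambda>t. - sgn (h (t - \<tau>)) + c * cos (2 * pi * t)) has_integral h (\<alpha> + \<tau> + 1) - h (\<alpha> + \<tau>)) {\<alpha>+\<tau>..\<alpha>+\<tau>+1}"
    by (intro dde_solution_has_integral[OF sol]) auto
  moreover have "((\<lambda>t. c * cos (2 * pi * t)) has_integral
      c / (2 * pi) * sin (2 * pi * (\<alpha> + \<tau> + 1)) - c / (2 * pi) * sin (2 * pi * (\<alpha> + \<tau>))) {\<alpha>+\<tau>..\<alpha>+\<tau>+1}"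
    by (intro fundamental_theorem_of_calculus)
      (auto intro!: derivative_eq_intros simp flip: has_real_derivative_iff_has_vector_derivative)
  moreover have "sin (2 * pi * (\<alpha> + \<tau> + 1)) = sin (2 * pi * (\<alpha> + \<tau>))"
    using sin_periodic[of "2 * pi * (\<alpha> + \<tau>)"] by (simp add: algebra_simps)
  moreover have "h (\<alpha> + \<tau> + 1) = h (\<alpha> + \<tau>)"
    using perh by (simp add: has_period_def)
  ultimately have "((\<lambda>t. - sgn (h (t - \<tau>)) + c * cos (2 * pi * t)) has_integral 0) {\<alpha>+\<tau>..\<alpha>+\<tau>+1}"
    and "((\<lambda>t. c * cos (2 * pi * t)) has_integral 0) {\<alpha>+\<tau>..\<alpha>+\<tau>+1}"
    by simp_all
  from has_integral_diff[OF this(2,1)] have "((\<lambda>t. sgn (h (t - \<tau>))) has_integral 0) {\<alpha>+\<tau>..\<alpha>+\<tau>+1}"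
    by simp
  then have "((\<lambda>t. sgn (h t)) has_integral 0) {\<alpha>..\<alpha>+1}"
    by (subst has_integral_shift_real_ivl_iff[where c = "- \<tau>"]) (simp add: add_ac)
  \<comment> \<open>Only one sign change is inside the period, so the last of the three pieces is
    degenerate: \<open>r = w = \<alpha> + 1\<close>.\<close>
  moreover have "((\<lambda>t. sgn (h t)) has_integral 1 * (2 * \<beta> - 2 * (\<alpha> + 1) + (\<alpha> + 1) - \<alpha>)) {\<alpha>..\<alpha>+1}"
    using pos neg \<beta> by (intro has_integral_sgn_alternating) auto
  ultimately have "0 = 1 * (2 * \<beta> - 2 * (\<alpha> + 1) + (\<alpha> + 1) - \<alpha>)"
    by (rule has_integral_unique)
  then have \<beta>_eq: "\<beta> = \<alpha> + 1/2" by simp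
  then show pos': "\<And>t. t \<in> {\<alpha><..<\<alpha>+1/2} \<Longrightarrow> h t > 0"
    using pos by simp
  have sgn1: "sgn (h (t + 1/2)) = - sgn (h t)" if "t \<in> {\<alpha>..<\<alpha>+1}" for t
  proof -
    have "t = \<alpha> \<or> t \<in> {\<alpha><..<\<beta>} \<or> t = \<beta> \<or> t \<in> {\<beta><..<\<alpha>+1}"
      using that by auto
    then consider "t = \<alpha>" | "t \<in> {\<alpha><..<\<beta>}" | "t = \<beta>" | "t \<in> {\<beta><..<\<alpha>+1}"
      by blast
    then show ?thesis
    proof cases
      case 1
      then show ?thesis using h\<alpha> \<beta> \<beta>_eq by simp
    next
      case 2
      then show ?thesis using pos[of t] neg[of "t + 1/2"] \<beta>_eq by simp
    next
      case 3
      then show ?thesis using h\<alpha> \<beta>(3) \<beta>_eq has_period_of_int[OF perh, of \<alpha> 1] by (simp add: add_ac)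
    next
      case 4
      then show ?thesis
        using neg[of t] pos[of "t - 1/2"] \<beta>_eq has_period_of_int[OF perh, of "t - 1/2" 1] by (simp add: algebra_simps)
    qed
  qed
  have sgn: "sgn (h (t + 1/2)) = - sgn (h t)" for t
  proof -
    define s where "s = \<alpha> + frac (t - \<alpha>)"
    have t: "t = s + of_int \<lfloor>t - \<alpha>\<rfloor>" "t + 1/2 = s + 1/2 + of_int \<lfloor>t - \<alpha>\<rfloor>"
      by (simp_all add: s_def frac_def)
    have "h t = h s" "h (t + 1/2) = h (s + 1/2)"
      by (subst t, rule has_period_of_int[OF perh])+
    moreover have "s \<in> {\<alpha>..<\<alpha>+1}"
      by (simp add: s_def frac_lt_1)
    ultimately show ?thesis using sgn1 by simp
  qed
  have D: "h (b + 1/2) + h b = h (a + 1/2) + h a" if "a \<le> b" for a b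
  proof -
    have 1: "((\<lambda>t. - sgn (h (t - \<tau>)) + c * cos (2 * pi * t)) has_integral h b - h a) {a..b}"
      using that by (intro dde_solution_has_integral[OF sol]) auto
    have "((\<lambda>t. - sgn (h (t - \<tau>)) + c * cos (2 * pi * t)) has_integral h (b + 1/2) - h (a + 1/2)) {a+1/2..b+1/2}"
      using that by (intro dde_solution_has_integral[OF sol]) auto
    from has_integral_shift_real_ivl[OF this, of "1/2"]
    have "((\<lambda>t. - sgn (h (t + 1/2 - \<tau>)) + c * cos (2 * pi * (t + 1/2))) has_integral h (b + 1/2) - h (a + 1/2)) {a..b}"
      by simp
    moreover have "- sgn (h (t + 1/2 - \<tau>)) + c * cos (2 * pi * (t + 1/2)) =
        - (- sgn (h (t - \<tau>)) + c * cos (2 * pi * t))" for t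
    proof -
      have "h (t + 1/2 - \<tau>) = h (t - \<tau> + 1/2)" by (simp add: algebra_simps)
      moreover have "cos (2 * pi * (t + 1/2)) = - cos (2 * pi * t)"
        using cos_periodic_pi[of "2 * pi * t"] by (simp add: algebra_simps)
      ultimately show ?thesis using sgn[of "t - \<tau>"] by simp
    qed
    ultimately have "((\<lambda>t. - (- sgn (h (t - \<tau>)) + c * cos (2 * pi * t))) has_integral h (b + 1/2) - h (a + 1/2)) {a..b}"
      by simp
    then have "h (b + 1/2) - h (a + 1/2) = - (h b - h a)"
      using has_integral_neg[OF 1] by (rule has_integral_unique)
    then show ?thesis by linarith
  qed
  show "h (t + 1/2) = - h t" for t
    using D[of \<alpha> t] D[of t \<alpha>] h\<alpha> \<beta>(3) \<beta>_eq by (cases "\<alpha> \<le> t") auto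
qed

lemma antiperiodic_translate:
  fixes h :: "real \<Rightarrow> real"
  assumes anti: "\<And>t. h (t + 1/2) = - h t"
  obtains \<sigma> :: real where "\<sigma> = 1 \<or> \<sigma> = -1" "\<And>t. h (t + of_int n / 2) = \<sigma> * h t"
proof -
  have nat: "h (t + of_nat k / 2) = (-1) ^ k * h t" for t k
  proof (induction k)
    case (Suc k)
    have "t + of_nat (Suc k) / 2 = t + of_nat k / 2 + 1/2"
      by (simp add: add_divide_distrib)
    then have "h (t + of_nat (Suc k) / 2) = - h (t + of_nat k / 2)"
      using anti[of "t + of_nat k / 2"] by (simp only:)
    then show ?case using Suc by simp
  qed simp
  define k where "k = nat \<bar>n\<bar>"
  have "h (t + of_int n / 2) = (-1) ^ k * h t" for t
  proof (cases "n \<ge> 0")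
    case True
    then show ?thesis using nat[of t k] by (simp add: k_def)
  next
    case False
    then have cancel: "t + of_int n / 2 + of_nat k / 2 = t"
      by (simp add: k_def)
    have "h t = (-1) ^ k * h (t + of_int n / 2)"
      using nat[of "t + of_int n / 2" k] by (simp only: cancel)
    then show ?thesis
      by (simp add: mult.assoc[symmetric] flip: power_add)
  qed
  then show ?thesis
    using that[of "(-1) ^ k"] by (meson neg_one_even_power neg_one_odd_power)
qed

section \<open>Displacement of zeros under perturbation\<close>

lemma perturbed_zero_displacement:
  fixes f :: "real \<Rightarrow> real"
  assumes cont: "continuous_on {-\<epsilon>..\<epsilon>} f" and f0: "f 0 = 0" and pos: "\<epsilon> > 0" "d > 0" "K \<ge> 0"
    and mono: "\<And>s t. \<lbrakk>-\<epsilon> \<le> s; s < t; t \<le> \<epsilon>\<rbrakk> \<Longrightarrow> d / 2 * (t - s) \<le> f t - f s"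
    and taylor: "\<And>t. \<bar>t\<bar> \<le> \<epsilon> \<Longrightarrow> \<bar>f t - d * t\<bar> \<le> K * t\<^sup>2"
    and e: "\<bar>e\<bar> \<le> d * \<epsilon> / 4"
  obtains r where "-\<epsilon> < r" "r < \<epsilon>" "\<And>t. \<lbrakk>-\<epsilon> \<le> t; t < r\<rbrakk> \<Longrightarrow> f t + e < 0"
    "\<And>t. \<lbrakk>r < t; t \<le> \<epsilon>\<rbrakk> \<Longrightarrow> f t + e > 0" "\<bar>r + e / d\<bar> \<le> 4 * K / d ^ 3 * e\<^sup>2"
proof -
  have "d * \<epsilon> > 0" using pos by simp
  moreover have "d / 2 * \<epsilon> \<le> f \<epsilon>" "d / 2 * \<epsilon> \<le> - f (-\<epsilon>)"
    using mono[of 0 \<epsilon>] mono[of "-\<epsilon>" 0] f0 pos by auto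
  ultimately have ends: "f \<epsilon> > -e" "f (-\<epsilon>) < -e"
    using e by auto
  obtain r where r: "-\<epsilon> \<le> r" "r \<le> \<epsilon>" "f r = -e"
    using IVT'[of f "-\<epsilon>" "-e" \<epsilon>] ends cont pos by auto
  have r': "-\<epsilon> < r" "r < \<epsilon>"
    using r ends by (auto simp: less_le)
  have "d / 2 * \<bar>r\<bar> \<le> \<bar>e\<bar>"
  proof (cases r "0::real" rule: linorder_cases)
    case less
    then show ?thesis using mono[of r 0] f0 r pos by auto
  next
    case greater
    then show ?thesis using mono[of 0 r] f0 r pos by auto
  qed simp
  then have "\<bar>r\<bar> \<le> 2 * \<bar>e\<bar> / d"
    using pos by (simp add: field_simps)
  then have "r\<^sup>2 \<le> (2 * \<bar>e\<bar> / d)\<^sup>2"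
    using power_mono[of "\<bar>r\<bar>" _ 2] by simp
  then have "K * r\<^sup>2 \<le> K * (4 * e\<^sup>2 / d\<^sup>2)"
    using pos by (intro mult_left_mono) (auto simp: power_divide power_mult_distrib)
  moreover have "\<bar>- e - d * r\<bar> \<le> K * r\<^sup>2"
    using taylor[of r] r by auto
  moreover have "\<bar>- e - d * r\<bar> = d * \<bar>r + e / d\<bar>"
  proof -
    have "- e - d * r = - (d * (r + e / d))" using pos by (simp add: field_simps)
    then show ?thesis using pos by (simp add: abs_mult)
  qed
  ultimately have "d * \<bar>r + e / d\<bar> \<le> K * (4 * e\<^sup>2 / d\<^sup>2)"
    by linarith
  then have "d * \<bar>r + e / d\<bar> / d \<le> K * (4 * e\<^sup>2 / d\<^sup>2) / d"
    using pos by (intro divide_right_mono) auto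
  then have "\<bar>r + e / d\<bar> \<le> K * (4 * e\<^sup>2 / d\<^sup>2) / d"
    using pos by simp
  also have "\<dots> = 4 * K / d ^ 3 * e\<^sup>2"
    by (simp add: power2_eq_square power3_eq_cube)
  finally have bound: "\<bar>r + e / d\<bar> \<le> 4 * K / d ^ 3 * e\<^sup>2" .
  have "f t + e < 0" if "-\<epsilon> \<le> t" "t < r" for t
  proof -
    have "0 < d / 2 * (r - t)" using that pos by simp
    then show ?thesis using mono[of t r] that r by linarith
  qed
  moreover have "f t + e > 0" if "r < t" "t \<le> \<epsilon>" for t
  proof -
    have "0 < d / 2 * (t - r)" using that pos by simp
    then show ?thesis using mono[of r t] that r by linarith
  qed
  ultimately show ?thesis using that r' bound by blast
qed

section \<open>The one-step error recursion along an antiperiodic orbit\<close>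

definition leading_order_step ::
  "(real \<Rightarrow> real) \<Rightarrow> real \<Rightarrow> real \<Rightarrow> real \<Rightarrow> real \<Rightarrow> real \<Rightarrow> real \<Rightarrow> bool" where
  "leading_order_step E d C a b z y \<longleftrightarrow>
     \<bar>E b - (E a - 2 * E z / d - 2 * E y / d)\<bar> \<le> C * ((E z)\<^sup>2 + (E y)\<^sup>2)"

text \<open>Antiperiodicity and positivity on one half period replace the definition of the orbit.
  The two ranges of \<open>\<theta>\<close> correspond to \<open>i = 2k\<close>,
  \<open>\<kappa> = \<theta>\<close> and to \<open>i = 2k + 1\<close>,
  \<open>\<kappa> = \<theta> - 1/2\<close>.\<close>

locale antiperiodic_orbit =
  fixes c \<tau> \<alpha> \<kappa> d :: real and i :: nat and h :: "real \<Rightarrow> real"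
  assumes sol: "dde_solution_on c \<tau> UNIV h"
    and anti: "h (t + 1/2) = - h t"
    and zero: "h \<alpha> = 0"
    and pos: "t \<in> {\<alpha><..<\<alpha>+1/2} \<Longrightarrow> h t > 0"
    and \<tau>_eq: "\<tau> = real i / 2 + \<kappa>"
    and \<kappa>: "0 < \<kappa>" "\<kappa> < 1/2"
    and d_eq: "d = deriv h \<alpha>"
    and d_pos: "d > 0"
begin

text \<open>Near \<open>\<alpha>\<close> the delayed sign is constant, so \<open>h\<close> differs
  by a constant from the explicit primitive \<open>Q\<close>. Slope and remainder bounds then follow
  from the mean value theorem for \<open>Q\<close>.\<close>

lemma local_shape:
  obtains \<epsilon> K where "0 < \<epsilon>" "\<epsilon> \<le> \<kappa> / 2" "\<epsilon> \<le> (1/2 - \<kappa>) / 2" "K > 0"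
    "\<And>s t. \<lbrakk>-\<epsilon> \<le> s; s < t; t \<le> \<epsilon>\<rbrakk> \<Longrightarrow> d / 2 * (t - s) \<le> h (\<alpha> + t) - h (\<alpha> + s)"
    "\<And>t. \<bar>t\<bar> \<le> \<epsilon> \<Longrightarrow> \<bar>h (\<alpha> + t) - d * t\<bar> \<le> K * t\<^sup>2"
proof -
  define \<epsilon>\<^sub>0 where "\<epsilon>\<^sub>0 = min \<kappa> (1/2 - \<kappa>) / 2"
  have \<epsilon>\<^sub>0: "0 < \<epsilon>\<^sub>0" "\<epsilon>\<^sub>0 \<le> \<kappa> / 2" "\<epsilon>\<^sub>0 \<le> (1/2 - \<kappa>) / 2"
    using \<kappa> by (auto simp: \<epsilon>\<^sub>0_def)
  \<comment> \<open>The translation by \<open>-(i + 1)/2\<close> takes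
    \<open>x - \<kappa> + 1/2\<close>, which lies in the half period where \<open>h\<close> is
    positive, to \<open>x - \<tau>\<close>.\<close>
  obtain \<sigma> :: real where \<sigma>: "\<sigma> = 1 \<or> \<sigma> = -1" and h\<sigma>: "\<And>t. h (t + of_int (- int i - 1) / 2) = \<sigma> * h t"
    using antiperiodic_translate[of h "- int i - 1"] anti by blast
  have sgn: "sgn (h (x - \<tau>)) = \<sigma>" if "x \<in> {\<alpha>-\<epsilon>\<^sub>0..\<alpha>+\<epsilon>\<^sub>0}" for x
  proof -
    have "x - \<kappa> + 1/2 + of_int (- int i - 1) / 2 = x - \<tau>"
      by (simp add: \<tau>_eq diff_divide_distrib)
    then have "h (x - \<tau>) = \<sigma> * h (x - \<kappa> + 1/2)"
      using h\<sigma>[of "x - \<kappa> + 1/2"] by (simp only:)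
    moreover have "h (x - \<kappa> + 1/2) > 0"
      using that \<epsilon>\<^sub>0 \<kappa> by (intro pos) auto
    ultimately show ?thesis using \<sigma> by (auto simp: sgn_mult)
  qed
  define Q where "Q x = - \<sigma> * x + c / (2 * pi) * sin (2 * pi * x)" for x
  define q where "q x = - \<sigma> + c * cos (2 * pi * x)" for x
  have Q: "(Q has_real_derivative q x) (at x)" for x
    unfolding Q_def q_def by (auto intro!: derivative_eq_intros)
  have hQ_le: "h y - h x = Q y - Q x" if "\<alpha> - \<epsilon>\<^sub>0 \<le> x" "x \<le> y" "y \<le> \<alpha> + \<epsilon>\<^sub>0" for x y
  proof -
    have "((\<lambda>t. - sgn (h (t - \<tau>)) + c * cos (2 * pi * t)) has_integral h y - h x) {x..y}"
      using that by (intro dde_solution_has_integral[OF sol]) auto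
    then have "(q has_integral h y - h x) {x..y}"
      by (rule has_integral_eq[rotated]) (use that sgn in \<open>auto simp: q_def\<close>)
    moreover have "(q has_integral Q y - Q x) {x..y}"
      using that Q by (intro fundamental_theorem_of_calculus)
        (auto simp flip: has_real_derivative_iff_has_vector_derivative intro: has_field_derivative_at_within)
    ultimately show ?thesis by (rule has_integral_unique)
  qed
  have hQ: "h y - h x = Q y - Q x" if "x \<in> {\<alpha>-\<epsilon>\<^sub>0..\<alpha>+\<epsilon>\<^sub>0}" "y \<in> {\<alpha>-\<epsilon>\<^sub>0..\<alpha>+\<epsilon>\<^sub>0}" for x y
  proof (cases "x \<le> y")
    case False
    then have "h x - h y = Q x - Q y" using that by (intro hQ_le) auto
    then show ?thesis by linarith
  qed (use that hQ_le in auto)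
  have "(h has_real_derivative q \<alpha>) (at \<alpha>)"
  proof (rule has_field_derivative_transform_within[where d = \<epsilon>\<^sub>0])
    show "((\<lambda>x. h \<alpha> + (Q x - Q \<alpha>)) has_real_derivative q \<alpha>) (at \<alpha>)"
      using Q by (auto intro!: derivative_eq_intros)
    show "h \<alpha> + (Q x - Q \<alpha>) = h x" if "dist x \<alpha> < \<epsilon>\<^sub>0" for x
    proof -
      have "h x - h \<alpha> = Q x - Q \<alpha>"
        using that by (intro hQ) (auto simp: dist_real_def abs_less_iff)
      then show ?thesis by linarith
    qed
  qed (use \<epsilon>\<^sub>0 in auto)
  then have d: "d = q \<alpha>"
    using DERIV_imp_deriv d_eq by blast
  \<comment> \<open>A Lipschitz constant for \<open>q\<close>; the summand 1 keeps it positive when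
    \<open>c = 0\<close>.\<close>
  define K where "K = 2 * pi * \<bar>c\<bar> + 1"
  have "K > 0" by (simp add: K_def add_nonneg_pos)
  have q_lip: "\<bar>q (\<alpha> + t) - d\<bar> \<le> K * \<bar>t\<bar>" for t
  proof -
    have "\<bar>cos (2 * pi * (\<alpha> + t)) - cos (2 * pi * \<alpha>)\<bar> =
        2 * (\<bar>sin ((2 * pi * (\<alpha> + t) + 2 * pi * \<alpha>) / 2)\<bar> * \<bar>sin ((2 * pi * \<alpha> - 2 * pi * (\<alpha> + t)) / 2)\<bar>)"
      by (simp add: cos_diff_cos abs_mult)
    also have "\<dots> \<le> 2 * (1 * \<bar>(2 * pi * \<alpha> - 2 * pi * (\<alpha> + t)) / 2\<bar>)"
      by (intro mult_left_mono mult_mono abs_sin_x_le_abs_x) auto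
    also have "(2 * pi * \<alpha> - 2 * pi * (\<alpha> + t)) / 2 = - (pi * t)"
      by (simp add: algebra_simps)
    finally have "\<bar>cos (2 * pi * (\<alpha> + t)) - cos (2 * pi * \<alpha>)\<bar> \<le> 2 * pi * \<bar>t\<bar>"
      by (simp add: abs_mult)
    then have "\<bar>c\<bar> * \<bar>cos (2 * pi * (\<alpha> + t)) - cos (2 * pi * \<alpha>)\<bar> \<le> \<bar>c\<bar> * (2 * pi * \<bar>t\<bar>)"
      by (intro mult_left_mono) auto
    moreover have "q (\<alpha> + t) - d = c * (cos (2 * pi * (\<alpha> + t)) - cos (2 * pi * \<alpha>))"
      by (simp add: d q_def right_diff_distrib)
    then have "\<bar>q (\<alpha> + t) - d\<bar> = \<bar>c\<bar> * \<bar>cos (2 * pi * (\<alpha> + t)) - cos (2 * pi * \<alpha>)\<bar>"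
      by (simp only: abs_mult)
    moreover have "K * \<bar>t\<bar> = \<bar>c\<bar> * (2 * pi * \<bar>t\<bar>) + \<bar>t\<bar>"
      by (simp add: K_def algebra_simps)
    ultimately show ?thesis
      using abs_ge_zero[of t] by linarith
  qed
  have mvt: "\<exists>\<xi>. s < \<xi> \<and> \<xi> < t \<and> h (\<alpha> + t) - h (\<alpha> + s) = (t - s) * q (\<alpha> + \<xi>)"
    if "-\<epsilon>\<^sub>0 \<le> s" "s < t" "t \<le> \<epsilon>\<^sub>0" for s t
  proof -
    have "\<alpha> + s < \<alpha> + t" using that by simp
    from MVT2[OF this Q] obtain z where "\<alpha> + s < z" "z < \<alpha> + t" "Q (\<alpha> + t) - Q (\<alpha> + s) = (\<alpha> + t - (\<alpha> + s)) * q z"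
      by blast
    then show ?thesis
      using hQ[of "\<alpha> + s" "\<alpha> + t"] that by (intro exI[of _ "z - \<alpha>"]) simp
  qed
  \<comment> \<open>On this radius \<open>q\<close> deviates from \<open>d\<close> by at most
    \<open>d / 2\<close>, hence stays at least \<open>d / 2\<close>.\<close>
  define \<epsilon> where "\<epsilon> = min \<epsilon>\<^sub>0 (d / (2 * K))"
  have \<epsilon>: "0 < \<epsilon>" "\<epsilon> \<le> \<epsilon>\<^sub>0" "K * \<epsilon> \<le> d / 2"
    using \<epsilon>\<^sub>0 d_pos \<open>K > 0\<close> by (auto simp: \<epsilon>_def min_def field_simps)
  have mono: "d / 2 * (t - s) \<le> h (\<alpha> + t) - h (\<alpha> + s)" if st: "-\<epsilon> \<le> s" "s < t" "t \<le> \<epsilon>" for s t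
  proof -
    obtain \<xi> where \<xi>: "s < \<xi>" "\<xi> < t" "h (\<alpha> + t) - h (\<alpha> + s) = (t - s) * q (\<alpha> + \<xi>)"
      using mvt[of s t] st \<epsilon> by auto
    have "K * \<bar>\<xi>\<bar> \<le> K * \<epsilon>"
      using \<xi> st \<open>K > 0\<close> by (intro mult_left_mono) auto
    then have "d / 2 \<le> q (\<alpha> + \<xi>)"
      using q_lip[of \<xi>] \<epsilon> by linarith
    then have "(t - s) * (d / 2) \<le> (t - s) * q (\<alpha> + \<xi>)"
      using st by (intro mult_left_mono) auto
    then show ?thesis using \<xi>(3) by (simp add: mult.commute)
  qed
  have taylor: "\<bar>h (\<alpha> + t) - d * t\<bar> \<le> K * t\<^sup>2" if t: "\<bar>t\<bar> \<le> \<epsilon>" for t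
  proof -
    have "\<exists>\<xi>. \<bar>\<xi>\<bar> \<le> \<bar>t\<bar> \<and> h (\<alpha> + t) = t * q (\<alpha> + \<xi>)"
    proof (cases t "0::real" rule: linorder_cases)
      case less
      then obtain \<xi> where "t < \<xi>" "\<xi> < 0" "h (\<alpha> + 0) - h (\<alpha> + t) = (0 - t) * q (\<alpha> + \<xi>)"
        using mvt[of t 0] t \<epsilon> by auto
      then show ?thesis using zero by (intro exI[of _ \<xi>]) simp
    next
      case greater
      then obtain \<xi> where "0 < \<xi>" "\<xi> < t" "h (\<alpha> + t) - h (\<alpha> + 0) = (t - 0) * q (\<alpha> + \<xi>)"
        using mvt[of 0 t] t \<epsilon> by auto
      then show ?thesis using zero by (intro exI[of _ \<xi>]) simp
    qed (use zero in auto)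
    then obtain \<xi> where \<xi>: "\<bar>\<xi>\<bar> \<le> \<bar>t\<bar>" "h (\<alpha> + t) = t * q (\<alpha> + \<xi>)" by blast
    have "h (\<alpha> + t) - d * t = t * (q (\<alpha> + \<xi>) - d)"
      by (simp add: \<xi>(2) algebra_simps)
    moreover have "\<bar>q (\<alpha> + \<xi>) - d\<bar> \<le> K * \<bar>t\<bar>"
      using q_lip[of \<xi>] mult_left_mono[OF \<xi>(1), of K] \<open>K > 0\<close> by linarith
    then have "\<bar>t\<bar> * \<bar>q (\<alpha> + \<xi>) - d\<bar> \<le> \<bar>t\<bar> * (K * \<bar>t\<bar>)"
      by (intro mult_left_mono) auto
    moreover have "\<bar>t\<bar> * (K * \<bar>t\<bar>) = K * t\<^sup>2"
      by (simp add: power2_eq_square)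
    ultimately show ?thesis by (simp add: abs_mult)
  qed
  show ?thesis
    using that[of \<epsilon> K] \<epsilon> \<epsilon>\<^sub>0 \<open>K > 0\<close> mono taylor by auto
qed

lemma translate:
  obtains \<sigma> :: real where "\<sigma> = 1 \<or> \<sigma> = -1" "\<And>t. h (\<alpha> + of_int n / 2 + t) = \<sigma> * h (\<alpha> + t)"
proof -
  obtain \<sigma> :: real where "\<sigma> = 1 \<or> \<sigma> = -1" and \<sigma>: "\<And>t. h (t + of_int n / 2) = \<sigma> * h t"
    using antiperiodic_translate[of h n] anti by blast
  moreover have "h (\<alpha> + of_int n / 2 + t) = \<sigma> * h (\<alpha> + t)" for t
    using \<sigma>[of "\<alpha> + t"] by (simp add: add_ac)
  ultimately show ?thesis using that by blast
qed

text \<open>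
  The delayed argument of a point near a zero stays away from all zeros, so a perturbation is
  there exactly a vertical translate of \<open>h\<close>.
\<close>

lemma perturbation_const_near_zero:
  assumes \<epsilon>: "0 < \<epsilon>" "\<epsilon> \<le> \<kappa> / 2" "\<epsilon> \<le> (1/2 - \<kappa>) / 2"
    and far: "\<And>n t. \<epsilon> \<le> \<bar>t\<bar> \<Longrightarrow> \<bar>t\<bar> \<le> 1/2 - \<epsilon> \<Longrightarrow>
      \<alpha> + of_int n / 2 + t \<in> {w-\<epsilon>-\<tau>..w+\<epsilon>-\<tau>} \<Longrightarrow>
      sgn (g (\<alpha> + of_int n / 2 + t)) = sgn (h (\<alpha> + of_int n / 2 + t))"
    and w: "w = \<alpha> + of_int n / 2"
    and solg: "dde_solution_on c \<tau> S g" and S: "{w-\<epsilon>..w+\<epsilon>} \<subseteq> S"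
    and t: "\<bar>t\<bar> \<le> \<epsilon>"
  shows "g (w + t) - h (w + t) = g w - h w"
proof -
  have eq: "g y - h y = g x - h x" if xy: "w - \<epsilon> \<le> x" "x \<le> y" "y \<le> w + \<epsilon>" for x y
  proof -
    have "((\<lambda>s. sgn (h s) - sgn (g s)) has_integral (g y - h y) - (g x - h x)) {x-\<tau>..y-\<tau>}"
      using S xy by (intro dde_difference_has_integral[OF sol solg]) auto
    moreover have "((\<lambda>s. sgn (h s) - sgn (g s)) has_integral 0) {x-\<tau>..y-\<tau>}"
    proof (rule has_integral_is_0)
      fix s assume s: "s \<in> {x-\<tau>..y-\<tau>}"
      \<comment> \<open>The offset from the zero \<open>w - i/2\<close>. It differs from
        \<open>-\<kappa>\<close> by at most \<open>\<epsilon>\<close>, and the halves in the bounds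
        on \<open>\<epsilon>\<close> keep it at distance \<open>\<epsilon>\<close> from the
        neighbouring zeros.\<close>
      define u where "u = s - (w - real i / 2)"
      have s_eq: "s = \<alpha> + of_int (n - int i) / 2 + u"
        by (simp add: u_def w diff_divide_distrib)
      have "\<bar>u\<bar> = - u" "\<epsilon> \<le> - u" "- u \<le> 1/2 - \<epsilon>"
        using s xy \<epsilon> \<kappa> by (auto simp: u_def \<tau>_eq)
      then show "sgn (h s) - sgn (g s) = 0"
        using far[of u "n - int i"] s xy unfolding s_eq[symmetric] by auto
    qed
    ultimately have "(g y - h y) - (g x - h x) = 0" by (rule has_integral_unique)
    then show ?thesis by simp
  qed
  show ?thesis
    using eq[of w "w + t"] eq[of "w + t" w] t by (cases "t \<ge> 0") auto
qed

text \<open>Beyond distance \<open>\<epsilon>\<close> from \<open>w\<close> the sign is inherited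
  from \<open>h\<close>. Within it, \<open>g\<close> is \<open>\<sigma>\<close> times a vertical
  translate of \<open>h\<close> around \<open>\<alpha>\<close>, so downward zeros reduce to the
  upward one.\<close>

lemma perturbed_sign_pattern:
  assumes \<epsilon>: "0 < \<epsilon>" "\<epsilon> \<le> \<kappa> / 2" "\<epsilon> \<le> (1/2 - \<kappa>) / 2" and K: "K > 0"
    and mono: "\<And>s t. \<lbrakk>-\<epsilon> \<le> s; s < t; t \<le> \<epsilon>\<rbrakk> \<Longrightarrow> d / 2 * (t - s) \<le> h (\<alpha> + t) - h (\<alpha> + s)"
    and taylor: "\<And>t. \<bar>t\<bar> \<le> \<epsilon> \<Longrightarrow> \<bar>h (\<alpha> + t) - d * t\<bar> \<le> K * t\<^sup>2"
    and far: "\<And>n t. \<epsilon> \<le> \<bar>t\<bar> \<Longrightarrow> \<bar>t\<bar> \<le> 1/2 - \<epsilon> \<Longrightarrow>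
      \<alpha> + of_int n / 2 + t \<in> {w-1/2-\<tau>..w+1/2-\<epsilon>} \<Longrightarrow>
      sgn (g (\<alpha> + of_int n / 2 + t)) = sgn (h (\<alpha> + of_int n / 2 + t))"
    and w: "w = \<alpha> + of_int n / 2"
    and \<sigma>: "\<sigma> = 1 \<or> \<sigma> = -1" "\<And>t. h (w + t) = \<sigma> * h (\<alpha> + t)"
    and solg: "dde_solution_on c \<tau> S g" and S: "{w-\<epsilon>..w+\<epsilon>} \<subseteq> S"
    and small: "\<bar>g w - h w\<bar> \<le> d * \<epsilon> / 4"
  obtains r where "-\<epsilon> < r" "r < \<epsilon>"
    "\<And>t. \<lbrakk>- (1/2 - \<epsilon>) \<le> t; t < r\<rbrakk> \<Longrightarrow> sgn (g (w + t)) = - \<sigma>"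
    "\<And>t. \<lbrakk>r < t; t \<le> 1/2 - \<epsilon>\<rbrakk> \<Longrightarrow> sgn (g (w + t)) = \<sigma>"
    "\<bar>r + \<sigma> * (g w - h w) / d\<bar> \<le> 4 * K / d ^ 3 * (g w - h w)\<^sup>2"
proof -
  define e where "e = \<sigma> * (g w - h w)"
  have abs_e: "\<bar>e\<bar> = \<bar>g w - h w\<bar>" and e2: "e\<^sup>2 = (g w - h w)\<^sup>2"
    using \<sigma>(1) by (auto simp: e_def power2_commute)
  have \<tau>_ge: "\<tau> \<ge> \<kappa>" by (simp add: \<tau>_eq)
  have near: "g (w + t) = \<sigma> * (h (\<alpha> + t) + e)" if "\<bar>t\<bar> \<le> \<epsilon>" for t
  proof -
    have "g (w + t) - h (w + t) = g w - h w"
      by (rule perturbation_const_near_zero[OF \<epsilon> far w solg S that]) (use \<epsilon> \<kappa> \<tau>_ge in auto)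
    then have "g (w + t) = \<sigma> * h (\<alpha> + t) + (g w - h w)" using \<sigma>(2)[of t] by linarith
    then show ?thesis using \<sigma>(1) by (auto simp: e_def algebra_simps)
  qed
  have "continuous_on {-\<epsilon>..\<epsilon>} (\<lambda>t. h (\<alpha> + t))"
    by (intro continuous_on_compose2[OF dde_solution_continuous[OF sol, of UNIV]] continuous_intros) auto
  then obtain r where r: "-\<epsilon> < r" "r < \<epsilon>"
    and neg: "\<And>t. \<lbrakk>-\<epsilon> \<le> t; t < r\<rbrakk> \<Longrightarrow> h (\<alpha> + t) + e < 0"
    and posi: "\<And>t. \<lbrakk>r < t; t \<le> \<epsilon>\<rbrakk> \<Longrightarrow> h (\<alpha> + t) + e > 0"
    and bound: "\<bar>r + e / d\<bar> \<le> 4 * K / d ^ 3 * e\<^sup>2"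
    using perturbed_zero_displacement[of \<epsilon> "\<lambda>t. h (\<alpha> + t)" d K e] \<epsilon> d_pos K mono taylor small abs_e zero
    by auto
  have h_neg: "h (\<alpha> + t) < 0" if "-1/2 < t" "t < 0" for t
    using anti[of "\<alpha> + t"] pos[of "\<alpha> + t + 1/2"] that by auto
  have far': "sgn (g (w + t)) = \<sigma> * sgn (h (\<alpha> + t))" if "\<epsilon> \<le> \<bar>t\<bar>" "\<bar>t\<bar> \<le> 1/2 - \<epsilon>" for t
  proof -
    have "sgn (g (w + t)) = sgn (h (w + t))"
    proof -
      have "- (1/2 - \<epsilon>) \<le> t" "t \<le> 1/2 - \<epsilon>"
        using that(2) by linarith+
      then show ?thesis
        using far[OF that, of n] \<tau>_ge \<kappa> \<epsilon> by (auto simp: w)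
    qed
    then show ?thesis using \<sigma> by (auto simp: sgn_mult)
  qed
  show thesis
  proof (rule that[of r])
    show "sgn (g (w + t)) = - \<sigma>" if t: "- (1/2 - \<epsilon>) \<le> t" "t < r" for t
    proof (cases "t \<ge> -\<epsilon>")
      case True
      then show ?thesis using near[of t] neg[of t] r t \<sigma>(1) by (auto simp: sgn_mult)
    next
      case False
      then show ?thesis using far'[of t] h_neg[of t] \<epsilon> t by auto
    qed
    show "sgn (g (w + t)) = \<sigma>" if t: "r < t" "t \<le> 1/2 - \<epsilon>" for t
    proof (cases "t \<le> \<epsilon>")
      case True
      then show ?thesis using near[of t] posi[of t] r t \<sigma>(1) by (auto simp: sgn_mult)
    next
      case False
      then show ?thesis using far'[of t] pos[of "\<alpha> + t"] \<epsilon> t by auto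
    qed
    show "\<bar>r + \<sigma> * (g w - h w) / d\<bar> \<le> 4 * K / d ^ 3 * (g w - h w)\<^sup>2"
      using bound by (simp only: e2) (simp add: e_def)
  qed (use r in auto)
qed

text \<open>Antiperiodicity makes one compact interval between two zeros representative of all, so
  the margin does not depend on \<open>n\<close>.\<close>

lemma bounded_away_from_zeros:
  assumes "0 < \<epsilon>" "\<epsilon> < 1/4"
  obtains \<eta> where "\<eta> > 0"
    "\<And>n t. \<lbrakk>\<epsilon> \<le> \<bar>t\<bar>; \<bar>t\<bar> \<le> 1/2 - \<epsilon>\<rbrakk> \<Longrightarrow> \<eta> \<le> \<bar>h (\<alpha> + of_int n / 2 + t)\<bar>"
proof -
  obtain x where x: "x \<in> {\<alpha>+\<epsilon>..\<alpha>+1/2-\<epsilon>}" "\<And>y. y \<in> {\<alpha>+\<epsilon>..\<alpha>+1/2-\<epsilon>} \<Longrightarrow> h x \<le> h y"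
    using continuous_attains_inf[of "{\<alpha>+\<epsilon>..\<alpha>+1/2-\<epsilon>}" h] dde_solution_continuous[OF sol] assms by auto
  show ?thesis
  proof (rule that[of "h x"])
    show "h x > 0" using x(1) assms by (intro pos) auto
    fix n t assume t: "\<epsilon> \<le> \<bar>t\<bar>" "\<bar>t\<bar> \<le> 1/2 - \<epsilon>"
    obtain \<sigma> :: real where \<sigma>: "\<sigma> = 1 \<or> \<sigma> = -1" "h (\<alpha> + of_int n / 2 + t) = \<sigma> * h (\<alpha> + t)"
      using translate[of n] by metis
    have "h x \<le> \<bar>h (\<alpha> + t)\<bar>"
    proof (cases "t \<ge> 0")
      case True
      then show ?thesis using x(2)[of "\<alpha> + t"] t by auto
    next
      case False
      then show ?thesis using x(2)[of "\<alpha> + t + 1/2"] anti[of "\<alpha> + t"] t by auto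
    qed
    then show "h x \<le> \<bar>h (\<alpha> + of_int n / 2 + t)\<bar>"
      using \<sigma> by (auto simp: abs_mult)
  qed
qed

text \<open>The delayed window of the step is \<open>{z - \<kappa>..z + 1 - \<kappa>}\<close>. Since
  \<open>0 < \<kappa> < 1/2\<close>, it contains exactly the zeros \<open>z\<close> and
  \<open>z + 1/2\<close> of \<open>h\<close>, both in its interior.\<close>

proposition perturbation_step:
  "\<exists>\<delta>>0. \<exists>C>0. \<forall>(n::int) z g.
    z = \<alpha> + of_int n / 2 \<longrightarrow>
    dde_solution_on c \<tau> {z - 1/2..z + real i / 2 + 1} g \<longrightarrow>
    (\<forall>t\<in>{z - 1/2 - \<tau>..z + real i / 2 + 1}. \<bar>g t - h t\<bar> \<le> \<delta>) \<longrightarrow>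
    leading_order_step (\<lambda>t. g t - h t) d C (z + real i / 2) (z + real i / 2 + 1) z (z + 1/2)"
proof -
  obtain \<epsilon> K where \<epsilon>: "0 < \<epsilon>" "\<epsilon> \<le> \<kappa> / 2" "\<epsilon> \<le> (1/2 - \<kappa>) / 2" and K: "K > 0"
    and mono: "\<And>s t. \<lbrakk>-\<epsilon> \<le> s; s < t; t \<le> \<epsilon>\<rbrakk> \<Longrightarrow> d / 2 * (t - s) \<le> h (\<alpha> + t) - h (\<alpha> + s)"
    and taylor: "\<And>t. \<bar>t\<bar> \<le> \<epsilon> \<Longrightarrow> \<bar>h (\<alpha> + t) - d * t\<bar> \<le> K * t\<^sup>2"
    using local_shape by blast
  have "\<epsilon> < 1/4" using \<epsilon> \<kappa> by linarith
  then obtain \<eta> where \<eta>: "\<eta> > 0"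
    "\<And>n t. \<lbrakk>\<epsilon> \<le> \<bar>t\<bar>; \<bar>t\<bar> \<le> 1/2 - \<epsilon>\<rbrakk> \<Longrightarrow> \<eta> \<le> \<bar>h (\<alpha> + of_int n / 2 + t)\<bar>"
    using bounded_away_from_zeros[of \<epsilon>] \<epsilon> by blast
  \<comment> \<open>The first bound lets \<open>g\<close> inherit the sign of \<open>h\<close> away
    from the zeros; the second is the smallness required for locating the displaced zeros.\<close>
  define \<delta> where "\<delta> = min (\<eta> / 2) (d * \<epsilon> / 4)"
  have \<delta>: "\<delta> > 0" "\<delta> < \<eta>" "\<delta> \<le> d * \<epsilon> / 4"
    using \<eta>(1) \<epsilon> d_pos by (auto simp: \<delta>_def)
  define C where "C = 2 * (4 * K / d ^ 3)"
  have "C > 0" using K d_pos by (simp add: C_def)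
  have step: "leading_order_step (\<lambda>t. g t - h t) d C (z + real i / 2) (z + real i / 2 + 1) z (z + 1/2)"
    if z: "z = \<alpha> + of_int n / 2"
      and solg: "dde_solution_on c \<tau> {z - 1/2..z + real i / 2 + 1} g"
      and close: "\<forall>t\<in>{z - 1/2 - \<tau>..z + real i / 2 + 1}. \<bar>g t - h t\<bar> \<le> \<delta>"
    for n :: int and z and g :: "real \<Rightarrow> real"
  proof -
    have \<tau>_ge: "\<tau> \<ge> \<kappa>" by (simp add: \<tau>_eq)
    have far: "sgn (g (\<alpha> + of_int n / 2 + t)) = sgn (h (\<alpha> + of_int n / 2 + t))"
      if "\<epsilon> \<le> \<bar>t\<bar>" "\<bar>t\<bar> \<le> 1/2 - \<epsilon>" "\<alpha> + of_int n / 2 + t \<in> {z - 1/2 - \<tau>..z + real i / 2 + 1}" for n t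
      using \<eta>(2)[OF that(1,2), of n] bspec[OF close that(3)] \<delta>(2) by (auto simp: sgn_if)
    obtain \<sigma> :: real where \<sigma>: "\<sigma> = 1 \<or> \<sigma> = -1" "\<And>t. h (z + t) = \<sigma> * h (\<alpha> + t)"
      using translate[of n] unfolding z by blast
    have \<sigma>': "h (z + 1/2 + t) = - \<sigma> * h (\<alpha> + t)" for t
      using anti[of "z + t"] \<sigma>(2)[of t] by (simp add: add_ac)
    define e1 where "e1 = g z - h z"
    define e2 where "e2 = g (z + 1/2) - h (z + 1/2)"
    have "\<bar>e1\<bar> \<le> d * \<epsilon> / 4" "\<bar>e2\<bar> \<le> d * \<epsilon> / 4"
      using bspec[OF close, of z] bspec[OF close, of "z + 1/2"] \<delta>(3) \<tau>_ge \<kappa> by (auto simp: e1_def e2_def)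
    note small = this[unfolded e1_def e2_def]
    obtain r1 where r1: "-\<epsilon> < r1" "r1 < \<epsilon>"
      and left1: "\<And>t. \<lbrakk>- (1/2 - \<epsilon>) \<le> t; t < r1\<rbrakk> \<Longrightarrow> sgn (g (z + t)) = - \<sigma>"
      and right1: "\<And>t. \<lbrakk>r1 < t; t \<le> 1/2 - \<epsilon>\<rbrakk> \<Longrightarrow> sgn (g (z + t)) = \<sigma>"
      and bound1: "\<bar>r1 + \<sigma> * e1 / d\<bar> \<le> 4 * K / d ^ 3 * e1\<^sup>2"
      unfolding e1_def
      by (rule perturbed_sign_pattern[OF \<epsilon> K mono taylor far z \<sigma> solg _ small(1)])
        (use \<epsilon> \<tau>_ge \<kappa> in auto)
    obtain r2 where r2: "-\<epsilon> < r2" "r2 < \<epsilon>"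
      and left2: "\<And>t. \<lbrakk>- (1/2 - \<epsilon>) \<le> t; t < r2\<rbrakk> \<Longrightarrow> sgn (g (z + 1/2 + t)) = - (- \<sigma>)"
      and right2: "\<And>t. \<lbrakk>r2 < t; t \<le> 1/2 - \<epsilon>\<rbrakk> \<Longrightarrow> sgn (g (z + 1/2 + t)) = - \<sigma>"
      and bound2: "\<bar>r2 + - \<sigma> * e2 / d\<bar> \<le> 4 * K / d ^ 3 * e2\<^sup>2"
      unfolding e2_def
      by (rule perturbed_sign_pattern[OF \<epsilon> K mono taylor far _ _ \<sigma>' solg _ small(2), of "n + 1"])
        (use \<epsilon> \<tau>_ge \<kappa> \<sigma>(1) in \<open>auto simp: z add_divide_distrib\<close>)
    have "((\<lambda>x. sgn (g x)) has_integral
        - \<sigma> * (2 * (z + r1) - 2 * (z + 1/2 + r2) + (z + 1 - \<kappa>) - (z - \<kappa>))) {z-\<kappa>..z+1-\<kappa>}"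
    proof (rule has_integral_sgn_alternating)
      show "z - \<kappa> \<le> z + r1" "z + r1 \<le> z + 1/2 + r2" "z + 1/2 + r2 \<le> z + 1 - \<kappa>"
        using r1 r2 \<epsilon> \<kappa> by auto
      show "sgn (g x) = - \<sigma>" if "x \<in> {z - \<kappa><..<z + r1}" for x
        using left1[of "x - z"] that \<epsilon> \<kappa> by auto
      \<comment> \<open>The patterns around \<open>z\<close> and \<open>z + 1/2\<close> overlap
        between the two zeros. As \<open>\<epsilon> < 1/4\<close>, both reach the midpoint
        \<open>z + 1/4\<close>.\<close>
      show "sgn (g x) = - (- \<sigma>)" if "x \<in> {z + r1<..<z + 1/2 + r2}" for x
        using right1[of "x - z"] left2[of "x - z - 1/2"] that \<epsilon> \<kappa> by (cases "x \<le> z + 1/4") auto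
      show "sgn (g x) = - \<sigma>" if "x \<in> {z + 1/2 + r2<..<z + 1 - \<kappa>}" for x
        using right2[of "x - z - 1/2"] that \<epsilon> \<kappa> by auto
    qed
    moreover have "((\<lambda>x. sgn (h x)) has_integral
        - \<sigma> * (2 * z - 2 * (z + 1/2) + (z + 1 - \<kappa>) - (z - \<kappa>))) {z-\<kappa>..z+1-\<kappa>}"
    proof (rule has_integral_sgn_alternating)
      show "z - \<kappa> \<le> z" "z \<le> z + 1/2" "z + 1/2 \<le> z + 1 - \<kappa>"
        using \<kappa> by auto
      show "sgn (h x) = - \<sigma>" if "x \<in> {z - \<kappa><..<z}" for x
        using \<sigma>(2)[of "x - z"] anti[of "\<alpha> + x - z"] pos[of "\<alpha> + x - z + 1/2"] \<sigma>(1) that \<kappa>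
        by (auto simp: sgn_mult algebra_simps)
      show "sgn (h x) = - (- \<sigma>)" if "x \<in> {z<..<z + 1/2}" for x
        using \<sigma>(2)[of "x - z"] pos[of "\<alpha> + (x - z)"] \<sigma>(1) that by (auto simp: sgn_mult)
      show "sgn (h x) = - \<sigma>" if "x \<in> {z + 1/2<..<z + 1 - \<kappa>}" for x
        using \<sigma>'[of "x - z - 1/2"] pos[of "\<alpha> + (x - z - 1/2)"] \<sigma>(1) that \<kappa> by (auto simp: sgn_mult)
    qed
    ultimately have "((\<lambda>x. sgn (h x) - sgn (g x)) has_integral
        - \<sigma> * (2 * z - 2 * (z + 1/2) + (z + 1 - \<kappa>) - (z - \<kappa>)) -
        - \<sigma> * (2 * (z + r1) - 2 * (z + 1/2 + r2) + (z + 1 - \<kappa>) - (z - \<kappa>))) {z-\<kappa>..z+1-\<kappa>}"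
      by (intro has_integral_diff)
    moreover have "((\<lambda>x. sgn (h x) - sgn (g x)) has_integral
        (g (z + real i / 2 + 1) - h (z + real i / 2 + 1)) - (g (z + real i / 2) - h (z + real i / 2))) {z-\<kappa>..z+1-\<kappa>}"
    proof -
      have "z - \<kappa> = z + real i / 2 - \<tau>" "z + 1 - \<kappa> = z + real i / 2 + 1 - \<tau>"
        by (simp_all add: \<tau>_eq)
      then show ?thesis
        by (simp only:) (rule dde_difference_has_integral[OF sol solg], auto)
    qed
    ultimately have "- \<sigma> * (2 * z - 2 * (z + 1/2) + (z + 1 - \<kappa>) - (z - \<kappa>)) -
        - \<sigma> * (2 * (z + r1) - 2 * (z + 1/2 + r2) + (z + 1 - \<kappa>) - (z - \<kappa>)) =
      (g (z + real i / 2 + 1) - h (z + real i / 2 + 1)) - (g (z + real i / 2) - h (z + real i / 2))"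
      by (rule has_integral_unique)
    then have "(g (z + real i / 2 + 1) - h (z + real i / 2 + 1)) - (g (z + real i / 2) - h (z + real i / 2)) =
        2 * \<sigma> * (r1 - r2)"
      by (simp add: algebra_simps)
    \<comment> \<open>To first order \<open>r1\<close> is \<open>- \<sigma> * e1 / d\<close> and
      \<open>r2\<close> is \<open>\<sigma> * e2 / d\<close>. As \<open>\<sigma>\<close> squares to
      1, both contributions to \<open>2 * \<sigma> * (r1 - r2)\<close> come out with the sign
      minus.\<close>
    moreover have "2 * \<sigma> * (r1 - r2) + 2 * e1 / d + 2 * e2 / d =
        2 * \<sigma> * ((r1 + \<sigma> * e1 / d) - (r2 + - \<sigma> * e2 / d))"
      using \<sigma>(1) by (auto simp: algebra_simps)
    moreover have "\<bar>2 * \<sigma> * ((r1 + \<sigma> * e1 / d) - (r2 + - \<sigma> * e2 / d))\<bar> \<le>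
        2 * (4 * K / d ^ 3 * e1\<^sup>2 + 4 * K / d ^ 3 * e2\<^sup>2)"
      using bound1 bound2 \<sigma>(1) by auto
    moreover have "2 * (4 * K / d ^ 3 * e1\<^sup>2 + 4 * K / d ^ 3 * e2\<^sup>2) = C * (e1\<^sup>2 + e2\<^sup>2)"
      unfolding C_def by (simp only: distrib_left mult.assoc)
    ultimately show ?thesis
      unfolding leading_order_step_def e1_def[symmetric] e2_def[symmetric] by linarith
  qed
  show ?thesis
    by (rule exI[of _ \<delta>], rule conjI[OF \<delta>(1)], rule exI[of _ C], rule conjI[OF \<open>C > 0\<close>],
      intro allI impI step)
qed

end

text \<open>The two base zeros \<open>z\<close> give the steps starting at
  \<open>m + \<alpha>\<close> and at \<open>m + \<alpha> + 1/2\<close>. The prescribed intervals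
  contain what both steps need, because \<open>i/2 = \<tau> - \<kappa>\<close>.\<close>

lemma (in antiperiodic_orbit) small_perturbation_step:
  "\<exists>\<delta>>0. \<exists>C>0. \<forall>m g z.
    small_perturbation c \<tau> \<alpha> m \<delta> h g \<longrightarrow>
    z = of_int m + \<alpha> - real i / 2 \<or> z = of_int m + \<alpha> - real i / 2 + 1/2 \<longrightarrow>
    leading_order_step (\<lambda>t. g t - h t) d C (z + real i / 2) (z + real i / 2 + 1) z (z + 1/2)"
proof -
  obtain \<delta> C where "\<delta> > 0" "C > 0" and step: "\<And>(n::int) z g. z = \<alpha> + of_int n / 2 \<Longrightarrow>
      dde_solution_on c \<tau> {z - 1/2..z + real i / 2 + 1} g \<Longrightarrow>
      (\<forall>t\<in>{z - 1/2 - \<tau>..z + real i / 2 + 1}. \<bar>g t - h t\<bar> \<le> \<delta>) \<Longrightarrow>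
      leading_order_step (\<lambda>t. g t - h t) d C (z + real i / 2) (z + real i / 2 + 1) z (z + 1/2)"
    using perturbation_step by blast
  have "leading_order_step (\<lambda>t. g t - h t) d C (z + real i / 2) (z + real i / 2 + 1) z (z + 1/2)"
    if pert: "small_perturbation c \<tau> \<alpha> m \<delta> h g"
      and z: "z = of_int m + \<alpha> - real i / 2 \<or> z = of_int m + \<alpha> - real i / 2 + 1/2" for m g z
  proof -
    have "\<exists>n::int. z = \<alpha> + of_int n / 2"
      using z
    proof
      assume "z = of_int m + \<alpha> - real i / 2"
      then show ?thesis
        by (intro exI[of _ "2 * m - int i"]) (simp add: diff_divide_distrib)
    next
      assume "z = of_int m + \<alpha> - real i / 2 + 1/2"
      then show ?thesis
        by (intro exI[of _ "2 * m - int i + 1"]) (simp add: diff_divide_distrib add_divide_distrib)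
    qed
    then obtain n :: int where n: "z = \<alpha> + of_int n / 2" by blast
    have "dde_solution_on c \<tau> {z - 1/2..z + real i / 2 + 1} g"
      by (rule dde_solution_on_subset[of _ _ "{of_int m + \<alpha> - \<tau> - 1 .. of_int m + \<alpha> + 2}"])
        (use pert z \<kappa> in \<open>auto simp: small_perturbation_def \<tau>_eq\<close>)
    moreover have "\<bar>g t - h t\<bar> \<le> \<delta>" if "t \<in> {z - 1/2 - \<tau>..z + real i / 2 + 1}" for t
    proof -
      have "t \<in> {of_int m + \<alpha> - 2 * \<tau> - 1 .. of_int m + \<alpha> + 2}"
        using that z \<kappa> by (auto simp: \<tau>_eq)
      then show ?thesis using pert by (simp add: small_perturbation_def)
    qed
    ultimately show ?thesis
      by (intro step[OF n]) auto
  qed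
  then show ?thesis using \<open>\<delta> > 0\<close> \<open>C > 0\<close> by blast
qed

theorem proposition4p1:
  fixes c \<tau> \<theta> \<alpha> :: real and k :: nat and h :: "real \<Rightarrow> real"
  assumes "c \<ge> 0"
    and "\<tau> = real k + \<theta>"
    and "periodic_orbit_1_1 c \<tau> h"
    and "upward_crossing h \<alpha>"
    and "\<forall>z. h z = 0 \<longrightarrow> nondegenerate_zero h z"
    and "h differentiable (at \<alpha>)"
    and "deriv h \<alpha> > 0"
  shows "
    (0 < \<theta> \<and> \<theta> < 1/2 \<longrightarrow>
      (\<exists>\<delta>\<^sub>0>0. \<exists>C>0. \<forall>(m::int) g. small_perturbation c \<tau> \<alpha> m \<delta>\<^sub>0 h g \<longrightarrow>
         (let E = (\<lambda>t. g t - h t) in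
            \<bar>E (of_int m + 1 + \<alpha>) - (E (of_int m + \<alpha>) - 2 * E (of_int m - real k + \<alpha>) / deriv h \<alpha> - 2 * E (of_int m - real k + \<alpha> + 1/2) / deriv h \<alpha>)\<bar>
               \<le> C * ((E (of_int m - real k + \<alpha>))\<^sup>2 + (E (of_int m - real k + \<alpha> + 1/2))\<^sup>2) \<and>
            \<bar>E (of_int m + 3/2 + \<alpha>) - (E (of_int m + 1/2 + \<alpha>) - 2 * E (of_int m - real k + \<alpha> + 1/2) / deriv h \<alpha> - 2 * E (of_int m - real k + \<alpha> + 1) / deriv h \<alpha>)\<bar>
               \<le> C * ((E (of_int m - real k + \<alpha> + 1/2))\<^sup>2 + (E (of_int m - real k + \<alpha> + 1))\<^sup>2)))) \<and>
    (1/2 < \<theta> \<and> \<theta> < 1 \<longrightarrow>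
      (\<exists>\<delta>\<^sub>0>0. \<exists>C>0. \<forall>(m::int) g. small_perturbation c \<tau> \<alpha> m \<delta>\<^sub>0 h g \<longrightarrow>
         (let E = (\<lambda>t. g t - h t) in
            \<bar>E (of_int m + 1 + \<alpha>) - (E (of_int m + \<alpha>) - 2 * E (of_int m - real k - 1/2 + \<alpha>) / deriv h \<alpha> - 2 * E (of_int m - real k + \<alpha>) / deriv h \<alpha>)\<bar>
               \<le> C * ((E (of_int m - real k - 1/2 + \<alpha>))\<^sup>2 + (E (of_int m - real k + \<alpha>))\<^sup>2) \<and>
            \<bar>E (of_int m + 3/2 + \<alpha>) - (E (of_int m + 1/2 + \<alpha>) - 2 * E (of_int m - real k + \<alpha>) / deriv h \<alpha> - 2 * E (of_int m - real k + \<alpha> + 1/2) / deriv h \<alpha>)\<bar>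
               \<le> C * ((E (of_int m - real k + \<alpha>))\<^sup>2 + (E (of_int m - real k + \<alpha> + 1/2))\<^sup>2))))"
proof -
  have sol: "dde_solution_on c \<tau> UNIV h"
    using assms(3) by (simp add: periodic_orbit_1_1_def)
  have zero: "h \<alpha> = 0"
    using assms(4) by (simp add: upward_crossing_def nondegenerate_zero_def)
  have nd: "\<And>z. h z = 0 \<Longrightarrow> nondegenerate_zero h z"
    using assms(5) by blast
  have step: "\<exists>\<delta>>0. \<exists>C>0. \<forall>m g z.
    small_perturbation c \<tau> \<alpha> m \<delta> h g \<longrightarrow>
    z = of_int m + \<alpha> - real i / 2 \<or> z = of_int m + \<alpha> - real i / 2 + 1/2 \<longrightarrow>
    leading_order_step (\<lambda>t. g t - h t) (deriv h \<alpha>) C (z + real i / 2) (z + real i / 2 + 1) z (z + 1/2)"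
    if "\<tau> = real i / 2 + \<kappa>" "0 < \<kappa>" "\<kappa> < 1/2" for \<kappa> i
  proof -
    interpret antiperiodic_orbit c \<tau> \<alpha> \<kappa> "deriv h \<alpha>" i h
      using orbit_half_period[OF assms(3,4) nd] sol zero that assms(7) by unfold_locales auto
    show ?thesis by (rule small_perturbation_step)
  qed
  show ?thesis (is "(_ \<longrightarrow> ?A) \<and> (_ \<longrightarrow> ?B)")
  proof (intro conjI impI)
    assume "0 < \<theta> \<and> \<theta> < 1/2"
    moreover have "\<tau> = real (2 * k) / 2 + \<theta>"
      using assms(2) by simp
    ultimately obtain \<delta> C where "\<delta> > 0" "C > 0" and "\<And>m g z.
        small_perturbation c \<tau> \<alpha> m \<delta> h g \<Longrightarrow>
        z = of_int m + \<alpha> - real (2 * k) / 2 \<or> z = of_int m + \<alpha> - real (2 * k) / 2 + 1/2 \<Longrightarrow>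
        leading_order_step (\<lambda>t. g t - h t) (deriv h \<alpha>) C (z + real (2 * k) / 2) (z + real (2 * k) / 2 + 1) z (z + 1/2)"
      using step[of "2 * k" "\<theta>"] by blast
    \<comment> \<open>The equations for the arguments become premises, so that the displayed forms
      are matched by arithmetic.\<close>
    then have *: "leading_order_step (\<lambda>t. g t - h t) (deriv h \<alpha>) C a b z y"
      if "small_perturbation c \<tau> \<alpha> m \<delta> h g"
        "z = of_int m + \<alpha> - real (2 * k) / 2 \<or> z = of_int m + \<alpha> - real (2 * k) / 2 + 1/2"
        "a = z + real (2 * k) / 2" "b = z + real (2 * k) / 2 + 1" "y = z + 1/2" for m g a b z y
      unfolding that(3-5) using that(1,2) by blast
    have "leading_order_step (\<lambda>t. g t - h t) (deriv h \<alpha>) C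
          (of_int m + \<alpha>) (of_int m + 1 + \<alpha>) (of_int m - real k + \<alpha>) (of_int m - real k + \<alpha> + 1/2)"
      "leading_order_step (\<lambda>t. g t - h t) (deriv h \<alpha>) C
          (of_int m + 1/2 + \<alpha>) (of_int m + 3/2 + \<alpha>) (of_int m - real k + \<alpha> + 1/2) (of_int m - real k + \<alpha> + 1)"
      if "small_perturbation c \<tau> \<alpha> m \<delta> h g" for m g
      by (intro *[OF that]; simp add: field_simps)+
    then show ?A
      using \<open>\<delta> > 0\<close> \<open>C > 0\<close> unfolding leading_order_step_def Let_def by blast
  next
    assume "1/2 < \<theta> \<and> \<theta> < 1"
    then have "0 < \<theta> - 1/2" "\<theta> - 1/2 < 1/2" by auto
    \<comment> \<open>An odd number of half periods moves both base zeros half a period earlier than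
      in the first case.\<close>
    moreover have "\<tau> = real (2 * k + 1) / 2 + (\<theta> - 1/2)"
      using assms(2) by (simp add: add_divide_distrib)
    ultimately obtain \<delta> C where "\<delta> > 0" "C > 0" and "\<And>m g z.
        small_perturbation c \<tau> \<alpha> m \<delta> h g \<Longrightarrow>
        z = of_int m + \<alpha> - real (2 * k + 1) / 2 \<or> z = of_int m + \<alpha> - real (2 * k + 1) / 2 + 1/2 \<Longrightarrow>
        leading_order_step (\<lambda>t. g t - h t) (deriv h \<alpha>) C (z + real (2 * k + 1) / 2) (z + real (2 * k + 1) / 2 + 1) z (z + 1/2)"
      using step[of "2 * k + 1" "\<theta> - 1/2"] by blast
    then have *: "leading_order_step (\<lambda>t. g t - h t) (deriv h \<alpha>) C a b z y"
      if "small_perturbation c \<tau> \<alpha> m \<delta> h g"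
        "z = of_int m + \<alpha> - real (2 * k + 1) / 2 \<or> z = of_int m + \<alpha> - real (2 * k + 1) / 2 + 1/2"
        "a = z + real (2 * k + 1) / 2" "b = z + real (2 * k + 1) / 2 + 1" "y = z + 1/2" for m g a b z y
      unfolding that(3-5) using that(1,2) by blast
    have "leading_order_step (\<lambda>t. g t - h t) (deriv h \<alpha>) C
          (of_int m + \<alpha>) (of_int m + 1 + \<alpha>) (of_int m - real k - 1/2 + \<alpha>) (of_int m - real k + \<alpha>)"
      "leading_order_step (\<lambda>t. g t - h t) (deriv h \<alpha>) C
          (of_int m + 1/2 + \<alpha>) (of_int m + 3/2 + \<alpha>) (of_int m - real k + \<alpha>) (of_int m - real k + \<alpha> + 1/2)"
      if "small_perturbation c \<tau> \<alpha> m \<delta> h g" for m g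
      by (intro *[OF that]; simp add: field_simps)+
    then show ?B
      using \<open>\<delta> > 0\<close> \<open>C > 0\<close> unfolding leading_order_step_def Let_def by blast
  qed
qed

end
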